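(* Let $U:\mathbb{R}^d\to\mathbb{R}$ be continuously differentiable, and let $L\ge 0$, $m>0$ be such that for all $x,y\in\mathbb{R}^d$, $\|\nabla U(x)-\nabla U(y)\|\le L\|x-y\|$ and $U(y)\ge U(x)+\langle\nabla U(x),y-x\rangle+(m/2)\|x-y\|^2$. Let $(\gamma_k)_{k\ge1}$ be a non-increasing sequence of positive real numbers with $\gamma_1\le2/(m+L)$ and let $f:\mathbb{R}^d\to\mathbb{R}$ be a Lipschitz function. Then for all $N\ge0$, $n\ge1$ and every starting point $x\in\mathbb{R}^d$, $$\mathrm{Var}_x\{\hat\pi_n^N(f)\}\le8\kappa^{-2}\|f\|_{\mathrm{Lip}}^2\,\Gamma_{N+2,N+n+1}^{-1}\,v_{N,n}(\gamma),\qquad v_{N,n}(\gamma)=1+\Gamma_{N+2,N+n+1}^{-1}\left(\kappa^{-1}+2/(m+L)\right).$$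
   Context: Here $d\ge1$, $\kappa=2mL/(m+L)$, $\Gamma_{n,\ell}=\sum_{k=n}^\ell\gamma_k$. $(X_k)_{k\ge0}$ is the unadjusted Langevin chain $X_{k+1}=X_k-\gamma_{k+1}\nabla U(X_k)+\sqrt{2\gamma_{k+1}}Z_{k+1}$, where $(Z_k)_{k\ge1}$ are i.i.d. standard $d$-dimensional Gaussian vectors; $\mathrm{Var}_x$ is the variance when $X_0=x$. The weighted average estimator is $$\hat\pi_n^N(f)=\sum_{k=N+1}^{N+n}\omega_{k,n}^Nf(X_k),\qquad\omega_{k,n}^N=\gamma_{k+1}\Gamma_{N+2,N+n+1}^{-1}.$$ $\|f\|_{\mathrm{Lip}}=\sup_{x\ne y}|f(x)-f(y)|/\|x-y\|$ is the Lipschitz constant of $f$. *)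

theory Defs
  imports "HOL-Probability.Probability"
begin

definition lip_norm :: "('a::real_normed_vector \<Rightarrow> real) \<Rightarrow> real" where
  "lip_norm f = Sup {\<bar>f x - f y\<bar> / norm (x - y) | x y. x \<noteq> y}"

definition std_gaussian_density :: "real ^ 'd \<Rightarrow> real" where
  "std_gaussian_density z = (\<Prod>i\<in>UNIV. std_normal_density (z $ i))"

text \<open>The unadjusted Langevin chain started at \<open>x\<close>; \<open>Z 0\<close> and \<open>\<gamma> 0\<close> are never used.\<close>

primrec ula ::
  "(real ^ 'd \<Rightarrow> real ^ 'd) \<Rightarrow> (nat \<Rightarrow> real) \<Rightarrow> (nat \<Rightarrow> 'w \<Rightarrow> real ^ 'd) \<Rightarrow>
    real ^ 'd \<Rightarrow> nat \<Rightarrow> 'w \<Rightarrow> real ^ 'd" where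
  "ula gradU \<gamma> Z x 0 \<omega> = x"
| "ula gradU \<gamma> Z x (Suc k) \<omega> =
     ula gradU \<gamma> Z x k \<omega> - \<gamma> (Suc k) *\<^sub>R gradU (ula gradU \<gamma> Z x k \<omega>)
       + sqrt (2 * \<gamma> (Suc k)) *\<^sub>R Z (Suc k) \<omega>"

definition step_sum :: "(nat \<Rightarrow> real) \<Rightarrow> nat \<Rightarrow> nat \<Rightarrow> real" where
  "step_sum \<gamma> n l = (\<Sum>k=n..l. \<gamma> k)"

definition weight :: "(nat \<Rightarrow> real) \<Rightarrow> nat \<Rightarrow> nat \<Rightarrow> nat \<Rightarrow> real" where
  "weight \<gamma> N n k = \<gamma> (k + 1) / step_sum \<gamma> (N + 2) (N + n + 1)"

definition weighted_average ::
  "(nat \<Rightarrow> real) \<Rightarrow> nat \<Rightarrow> nat \<Rightarrow> ('a \<Rightarrow> real) \<Rightarrow> (nat \<Rightarrow> 'w \<Rightarrow> 'a) \<Rightarrow> 'w \<Rightarrow> real" where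
  "weighted_average \<gamma> N n f X \<omega> = (\<Sum>k=N+1..N+n. weight \<gamma> N n k * f (X k \<omega>))"

definition kappa :: "real \<Rightarrow> real \<Rightarrow> real" where
  "kappa m L = 2 * m * L / (m + L)"

definition var_factor :: "real \<Rightarrow> real \<Rightarrow> (nat \<Rightarrow> real) \<Rightarrow> nat \<Rightarrow> nat \<Rightarrow> real" where
  "var_factor m L \<gamma> N n =
     1 + inverse (step_sum \<gamma> (N + 2) (N + n + 1)) * (inverse (kappa m L) + 2 / (m + L))"

end

theory Submission
  imports Defs
begin

text \<open>The variance is split along the noise: \<open>X\<^sub>k\<close> enters the estimator together with everything that
  depends on it through a Lipschitz function of \<open>X\<^sub>k\<close>, and averaging out \<open>Z\<^sub>k\<close> costs, by the Gaussian
  Poincare inequality, at most \<open>2 \<gamma>\<^sub>k\<close> times the squared Lipschitz constant. The Lipschitz constants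
  stay bounded because the gradient step \<open>y \<mapsto> y - \<gamma> \<nabla>U y\<close> is \<open>sqrt (1 - \<kappa> \<gamma>)\<close>-Lipschitz, by
  cocoercivity of the gradient of a strongly convex smooth function.

  The Poincare inequality with constant 1 for a Lipschitz \<open>g\<close> comes from writing the standard
  Gaussian as \<open>(Z\<^sub>1 + \<dots> + Z\<^sub>n) / sqrt n\<close>: if the second differences of \<open>g\<close> are \<open>O(\<bar>u\<bar>\<bar>v\<bar>)\<close>, then \<open>g\<close>
  is affine up to \<open>O(1 / n)\<close> at scale \<open>1 / sqrt n\<close>, so each of the \<open>n\<close> steps contributes at most
  \<open>\<Lambda>\<^sup>2 / n + O(n powr (-3/2))\<close>. Both hypotheses on \<open>g\<close> are preserved by averaging, and convolution with
  a tent function reduces a general Lipschitz function to this case.\<close>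

section \<open>Gradient steps of strongly convex functions\<close>

text \<open>The functions averaged along the chain are known only through a Lipschitz constant, so
  no derivative of them is taken. Each variance estimate is carried as a nonnegative integral of
  squared deviations from some unspecified centre: integrability then follows from the estimate, and
  conditional means never have to be computed. The constants arise as follows. The factor
  \<open>sqrt (1 - \<kappa> * \<gamma> k)\<close> is at most
  \<open>1 - \<kappa> * \<gamma> k / 2\<close>, which balances the weights when the Lipschitz
  constant stays at \<open>2 * F / (\<kappa> * \<Gamma>)\<close>, with \<open>F\<close> that of
  \<open>f\<close> and \<open>\<Gamma>\<close> the total weight. Its square times the 2 from the
  noise variance \<open>2 * \<gamma> k\<close> gives \<open>8 / \<kappa>\<^sup>2\<close>. In the
  variance factor, 1 is the averaging window, \<open>1 / \<kappa>\<close> the burn-in, and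
  \<open>2 / (m + L)\<close> pays for weights that run one index ahead of the noise.\<close>

lemma descent_lemma:
  fixes U :: "'a::real_inner \<Rightarrow> real"
  assumes grad: "\<And>y. GDERIV U y :> gradU y"
    and lip: "\<And>y z. norm (gradU y - gradU z) \<le> L * norm (y - z)"
  shows "U z \<le> U y + gradU y \<bullet> (z - y) + L / 2 * (norm (z - y))\<^sup>2"
proof -
  define d where "d = z - y"
  \<comment> \<open>\<open>\<psi>\<close> is the excess of \<open>U\<close> over its quadratic upper
    model along the segment, so the claim reads \<open>\<psi> 1 \<le> \<psi> 0\<close>;
    Cauchy-Schwarz and the Lipschitz bound make its derivative nonpositive.\<close>
  define \<psi> where "\<psi> t = U (y + t *\<^sub>R d) - t * (gradU y \<bullet> d) - L / 2 * t\<^sup>2 * (norm d)\<^sup>2" for t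
  have deriv: "(\<psi> has_real_derivative
      ((gradU (y + t *\<^sub>R d) - gradU y) \<bullet> d - L * t * (norm d)\<^sup>2)) (at t)" for t
  proof -
    have "((\<lambda>t. U (y + t *\<^sub>R d)) has_derivative (\<lambda>h. (h *\<^sub>R d) \<bullet> gradU (y + t *\<^sub>R d))) (at t)"
      using grad[of "y + t *\<^sub>R d"] unfolding gderiv_def
      by (rule has_derivative_compose[rotated]) (auto intro!: derivative_eq_intros)
    then have "((\<lambda>t. U (y + t *\<^sub>R d)) has_real_derivative gradU (y + t *\<^sub>R d) \<bullet> d) (at t)"
      by (simp add: has_field_derivative_def inner_commute mult.commute[of _ "_ \<bullet> _"])
    then show ?thesis
      unfolding \<psi>_def by (auto intro!: derivative_eq_intros simp: inner_diff_left)
  qed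
  have nonpos: "(gradU (y + t *\<^sub>R d) - gradU y) \<bullet> d - L * t * (norm d)\<^sup>2 \<le> 0" if "0 \<le> t" for t
  proof -
    have "(gradU (y + t *\<^sub>R d) - gradU y) \<bullet> d \<le> norm (gradU (y + t *\<^sub>R d) - gradU y) * norm d"
      by (rule norm_cauchy_schwarz)
    also have "\<dots> \<le> L * norm (t *\<^sub>R d) * norm d"
      using lip[of "y + t *\<^sub>R d" y] by (intro mult_right_mono) auto
    finally show ?thesis
      using that by (simp add: power2_eq_square mult_ac)
  qed
  have "\<psi> 1 \<le> \<psi> 0"
  proof (rule DERIV_nonpos_imp_nonincreasing[of 0 1 \<psi>])
    show "\<exists>y. (\<psi> has_real_derivative y) (at t) \<and> y \<le> 0" if "0 \<le> t" "t \<le> 1" for t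
      using deriv[of t] nonpos[OF that(1)] by (intro exI conjI)
  qed simp
  then show ?thesis
    by (simp add: \<psi>_def d_def)
qed

text \<open>Subtracting \<open>m / 2 * (norm y)\<^sup>2\<close> leaves a function \<open>p\<close>
  with gradient \<open>g\<close> that lies above its tangents and below parabolas of curvature
  \<open>L - m\<close>. It satisfies the Baillon-Haddad inequality, here
  \<open>(L - m) * A \<ge> B\<close>, which is then rewritten in terms of
  \<open>gradU\<close>.\<close>

lemma strongly_convex_cocoercive:
  fixes U :: "'a::real_inner \<Rightarrow> real"
  assumes grad: "\<And>y. GDERIV U y :> gradU y"
    and lip: "\<And>y z. norm (gradU y - gradU z) \<le> L * norm (y - z)"
    and conv: "\<And>y z. U z \<ge> U y + gradU y \<bullet> (z - y) + (m / 2) * (norm (y - z))\<^sup>2"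
    and mL: "m \<le> L"
  shows "(m + L) * ((gradU x - gradU y) \<bullet> (x - y))
    \<ge> (norm (gradU x - gradU y))\<^sup>2 + m * L * (norm (x - y))\<^sup>2"
proof -
  define g where "g y = gradU y - m *\<^sub>R y" for y
  define p where "p y = U y - m / 2 * (norm y)\<^sup>2" for y
  have lower: "p w \<ge> p y + g y \<bullet> (w - y)" for w y
    using conv[of y w]
    by (simp add: p_def g_def power2_norm_eq_inner inner_diff inner_commute algebra_simps)
  have upper: "p w \<le> p y + g y \<bullet> (w - y) + (L - m) / 2 * (norm (w - y))\<^sup>2" for w y
    using descent_lemma[OF grad lip, of w y]
    by (simp add: p_def g_def power2_norm_eq_inner inner_diff inner_commute field_simps)
  have half: "p y - p x - g x \<bullet> (y - x) \<ge> (s - (L - m) * s\<^sup>2 / 2) * (norm (g x - g y))\<^sup>2" for x y s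
  proof -
    \<comment> \<open>A step of length \<open>s\<close> from \<open>y\<close> down the gradient
      \<open>g y - g x\<close> of \<open>p\<close> minus its tangent at \<open>x\<close>. Leaving
      \<open>s\<close> free instead of fixing \<open>1 / (L - m)\<close> keeps the case
      \<open>L = m\<close> within reach.\<close>
    define w where "w = y + s *\<^sub>R (g x - g y)"
    have "p x + g x \<bullet> (w - x) \<le> p y + g y \<bullet> (w - y) + (L - m) / 2 * (norm (w - y))\<^sup>2"
      using lower[of x w] upper[of w y] by linarith
    then have "p y - p x - g x \<bullet> (y - x) \<ge> (g x - g y) \<bullet> (w - y) - (L - m) / 2 * (norm (w - y))\<^sup>2"
      by (simp add: inner_diff algebra_simps)
    moreover have "(g x - g y) \<bullet> (w - y) = s * (norm (g x - g y))\<^sup>2"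
      by (simp add: w_def power2_norm_eq_inner)
    moreover have "(norm (w - y))\<^sup>2 = s\<^sup>2 * (norm (g x - g y))\<^sup>2"
      by (simp add: w_def power_mult_distrib)
    ultimately show ?thesis
      by (simp add: algebra_simps diff_divide_distrib)
  qed
  define A where "A = (g x - g y) \<bullet> (x - y)"
  define B where "B = (norm (g x - g y))\<^sup>2"
  have s: "A \<ge> (2 * s - (L - m) * s\<^sup>2) * B" for s
  proof -
    \<comment> \<open>Using both orders of the two points cancels the values of
      \<open>p\<close>.\<close>
    have "(p x - p y - g y \<bullet> (x - y)) + (p y - p x - g x \<bullet> (y - x)) = A"
      by (simp add: A_def inner_diff algebra_simps)
    moreover have "(norm (g y - g x))\<^sup>2 = B" "(norm (g x - g y))\<^sup>2 = B"
      by (simp_all add: B_def norm_minus_commute)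
    ultimately have "A \<ge> (s - (L - m) * s\<^sup>2 / 2) * B + (s - (L - m) * s\<^sup>2 / 2) * B"
      using half[of s y x] half[of s x y] by (simp only:)
    then show ?thesis by (simp add: algebra_simps)
  qed
  \<comment> \<open>If \<open>L = m\<close> the bound is linear in \<open>s\<close>, so large
    \<open>s\<close> forces \<open>B = 0\<close>; otherwise \<open>s = 1 / (L - m)\<close> is the
    best choice.\<close>
  have AB: "(L - m) * A \<ge> B"
  proof (cases "L = m")
    case True
    have "B = 0"
    proof (rule ccontr)
      assume "B \<noteq> 0"
      then have "2 * ((A + 1) / (2 * B)) * B = A + 1" by simp
      with s[of "(A + 1) / (2 * B)"] True show False by (simp only:) simp
    qed
    with True show ?thesis by simp
  next
    case False
    define l where "l = L - m"
    have l: "l > 0" using False mL by (simp add: l_def)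
    then have "2 * (1 / l) - l * (1 / l)\<^sup>2 = 1 / l"
      by (simp add: power2_eq_square)
    with s[of "1 / l"] have "B / l \<le> A"
      by (simp add: l_def)
    with l show ?thesis
      by (simp add: l_def pos_divide_le_eq mult.commute)
  qed
  define a where "a = (gradU x - gradU y) \<bullet> (x - y)"
  define b where "b = (norm (gradU x - gradU y))\<^sup>2"
  define c where "c = (norm (x - y))\<^sup>2"
  have "A = a - m * c"
    unfolding A_def g_def a_def c_def power2_norm_eq_inner
    by (simp add: inner_diff inner_commute algebra_simps)
  moreover have "B = b - 2 * m * a + m\<^sup>2 * c"
    unfolding B_def g_def a_def b_def c_def power2_norm_eq_inner
    by (simp add: inner_diff inner_commute algebra_simps power2_eq_square)
  ultimately have "b - 2 * m * a + m\<^sup>2 * c \<le> (L - m) * (a - m * c)"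
    using AB by (simp only:)
  moreover have "(m + L) * a - (b + m * L * c) = (L - m) * (a - m * c) - (b - 2 * m * a + m\<^sup>2 * c)"
    by (simp add: algebra_simps power2_eq_square)
  ultimately have "b + m * L * c \<le> (m + L) * a"
    by linarith
  then show ?thesis
    unfolding a_def b_def c_def .
qed

text \<open>Expanding the square and inserting cocoercivity leaves the factor
  \<open>1 - kappa m L * g\<close> on \<open>(norm (x - y))\<^sup>2\<close>, plus
  \<open>g * (g - 2 / (m + L))\<close> times the squared gradient difference, which the step-size
  bound makes nonpositive.\<close>

lemma gradient_step_contraction:
  fixes gradU :: "'a::real_inner \<Rightarrow> 'a"
  assumes coco: "\<And>x y. (m + L) * ((gradU x - gradU y) \<bullet> (x - y))
      \<ge> (norm (gradU x - gradU y))\<^sup>2 + m * L * (norm (x - y))\<^sup>2"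
    and m: "m > 0" and L: "L \<ge> m" and g: "0 \<le> g" "g \<le> 2 / (m + L)"
  shows "norm ((x - g *\<^sub>R gradU x) - (y - g *\<^sub>R gradU y))
    \<le> sqrt (1 - kappa m L * g) * norm (x - y)"
proof -
  define a where "a = (gradU x - gradU y) \<bullet> (x - y)"
  define b where "b = (norm (gradU x - gradU y))\<^sup>2"
  define c where "c = (norm (x - y))\<^sup>2"
  have S: "m + L > 0" using m L by simp
  have "b + m * L * c \<le> a * (m + L)"
    using coco[of x y] by (simp add: a_def b_def c_def mult.commute)
  then have "(b + m * L * c) / (m + L) \<le> a"
    using S by (simp add: pos_divide_le_eq)
  then have co: "a \<ge> b / (m + L) + m * L / (m + L) * c"
    by (simp add: add_divide_distrib)
  have "(norm ((x - g *\<^sub>R gradU x) - (y - g *\<^sub>R gradU y)))\<^sup>2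
      = (norm ((x - y) - g *\<^sub>R (gradU x - gradU y)))\<^sup>2"
    by (simp add: algebra_simps)
  also have "\<dots> = c - 2 * g * a + g\<^sup>2 * b"
    unfolding a_def b_def c_def power2_norm_eq_inner
    by (simp add: inner_diff inner_commute algebra_simps power2_eq_square)
  also have "\<dots> \<le> c - 2 * g * (b / (m + L) + m * L / (m + L) * c) + g\<^sup>2 * b"
    using co g by (intro add_mono diff_mono mult_left_mono) auto
  also have "\<dots> = (1 - kappa m L * g) * c + g * (g - 2 / (m + L)) * b"
    by (simp add: kappa_def algebra_simps power2_eq_square)
  also have "g * (g - 2 / (m + L)) * b \<le> 0"
    using g by (intro mult_nonpos_nonneg mult_nonneg_nonpos) (auto simp: b_def)
  finally have "(norm ((x - g *\<^sub>R gradU x) - (y - g *\<^sub>R gradU y)))\<^sup>2 \<le> (1 - kappa m L * g) * c"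
    by simp
  then have "sqrt ((norm ((x - g *\<^sub>R gradU x) - (y - g *\<^sub>R gradU y)))\<^sup>2)
      \<le> sqrt ((1 - kappa m L * g) * c)"
    by (rule real_sqrt_le_mono)
  then show ?thesis
    by (simp add: c_def real_sqrt_mult)
qed

lemma kappa_pos: "0 < m \<Longrightarrow> m \<le> L \<Longrightarrow> 0 < kappa m L"
  by (simp add: kappa_def)

text \<open>Keeps the squared contraction factor \<open>1 - kappa m L * g\<close> nonnegative; at
  the largest step it reduces to \<open>4 * m * L \<le> (m + L)\<^sup>2\<close>.\<close>

lemma kappa_step_le_1:
  assumes "0 < m" "m \<le> L" "0 \<le> g" "g \<le> 2 / (m + L)"
  shows "kappa m L * g \<le> 1"
proof -
  have "kappa m L * g \<le> kappa m L * (2 / (m + L))"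
    using assms kappa_pos[of m L] by (intro mult_left_mono) auto
  also have "\<dots> = 4 * m * L / (m + L)\<^sup>2"
    by (simp add: kappa_def power2_eq_square)
  also have "\<dots> \<le> 1"
  proof -
    have "4 * m * L \<le> (m + L)\<^sup>2"
      using zero_le_power2[of "m - L"] by (simp add: power2_eq_square algebra_simps)
    then show ?thesis using assms by (simp add: divide_le_eq)
  qed
  finally show ?thesis .
qed

section \<open>Linearization from second differences\<close>

text \<open>Additivity gives homogeneity over the integers. For real \<open>c\<close>, rounding
  \<open>n * c\<close> to an integer shows that \<open>n\<close> times the defect
  \<open>A (c *\<^sub>R u) - c * A u\<close> stays bounded in \<open>n\<close>, so the defect
  vanishes.\<close>

lemma additive_bounded_imp_linear:
  fixes A :: "'a::real_normed_vector \<Rightarrow> real"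
  assumes add: "\<And>u v. A (u + v) = A u + A v"
    and bd: "\<And>u. \<bar>A u\<bar> \<le> K * norm u"
  shows "linear A"
proof (rule linearI)
  show "A (u + v) = A u + A v" for u v by (rule add)
  have zero: "A 0 = 0" using add[of 0 0] by simp
  have neg: "A (- u) = - A u" for u using add[of u "- u"] zero by simp
  have nat: "A (of_nat n *\<^sub>R u) = of_nat n * A u" for n u
    by (induction n) (simp_all add: zero add scaleR_add_left algebra_simps)
  have int: "A (of_int j *\<^sub>R u) = of_int j * A u" for j :: int and u
    by (cases j rule: int_cases2) (simp_all add: nat neg)
  fix c :: real and u :: 'a
  have "0 \<le> K * norm u" using bd[of u] by linarith
  have bound: "of_nat n * \<bar>A (c *\<^sub>R u) - c * A u\<bar> \<le> 2 * (K * norm u)" for n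
  proof -
    define j where "j = \<lfloor>of_nat n * c\<rfloor>"
    define r where "r = of_nat n * c - of_int j"
    have r: "\<bar>r\<bar> \<le> 1" unfolding r_def j_def by linarith
    have nc: "of_nat n * c = of_int j + r" by (simp add: r_def)
    have "of_nat n * (A (c *\<^sub>R u) - c * A u) = A ((of_nat n * c) *\<^sub>R u) - (of_nat n * c) * A u"
      using nat[of n "c *\<^sub>R u"] by (simp add: algebra_simps)
    also have "A ((of_nat n * c) *\<^sub>R u) = of_int j * A u + A (r *\<^sub>R u)"
      by (simp only: nc scaleR_add_left add int)
    also have "of_int j * A u + A (r *\<^sub>R u) - (of_nat n * c) * A u = A (r *\<^sub>R u) - r * A u"
      by (simp add: nc distrib_right)
    finally have "\<bar>of_nat n * (A (c *\<^sub>R u) - c * A u)\<bar> \<le> \<bar>A (r *\<^sub>R u)\<bar> + \<bar>r\<bar> * \<bar>A u\<bar>"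
      by (simp add: abs_mult[symmetric])
    also have "\<bar>A (r *\<^sub>R u)\<bar> \<le> \<bar>r\<bar> * (K * norm u)"
      using bd[of "r *\<^sub>R u"] by (simp add: mult_ac)
    also have "\<bar>r\<bar> * (K * norm u) \<le> K * norm u"
      using r \<open>0 \<le> K * norm u\<close> by (intro mult_left_le_one_le) auto
    also have "\<bar>r\<bar> * \<bar>A u\<bar> \<le> 1 * (K * norm u)"
      using r bd[of u] by (intro mult_mono) auto
    finally show ?thesis by (simp add: abs_mult)
  qed
  have "\<bar>A (c *\<^sub>R u) - c * A u\<bar> \<le> 0"
  proof (rule ccontr)
    assume "\<not> \<bar>A (c *\<^sub>R u) - c * A u\<bar> \<le> 0"
    then have "0 < \<bar>A (c *\<^sub>R u) - c * A u\<bar>" by simp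
    from reals_Archimedean3[OF this] obtain n where
      "2 * (K * norm u) < of_nat n * \<bar>A (c *\<^sub>R u) - c * A u\<bar>" by blast
    with bound[of n] show False by simp
  qed
  then show "A (c *\<^sub>R u) = c *\<^sub>R A u" by simp
qed

text \<open>Hyers' argument: if the second differences are \<open>O(\<bar>u\<bar>\<bar>v\<bar>)\<close>, then
  \<open>2\<^sup>k (h (x + u / 2\<^sup>k) - h x)\<close> converges to a linear function of \<open>u\<close>.\<close>

lemma second_difference_linearization:
  fixes h :: "'a::real_normed_vector \<Rightarrow> real"
  assumes lip: "\<And>x y. \<bar>h x - h y\<bar> \<le> \<Lambda> * norm (x - y)"
    and diff: "\<And>x u v. \<bar>h (x + u + v) - h (x + u) - h (x + v) + h x\<bar> \<le> C * norm u * norm v"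
  obtains A where "linear A" "\<And>u. \<bar>A u\<bar> \<le> \<Lambda> * norm u"
    "\<And>u. \<bar>h (x + u) - h x - A u\<bar> \<le> C * (norm u)\<^sup>2"
proof -
  define q where "q u = h (x + u) - h x" for u
  define s where "s u k = 2 ^ k * q ((1 / 2 ^ k) *\<^sub>R u)" for u and k :: nat
  have q_add: "\<bar>q (u + v) - q u - q v\<bar> \<le> C * norm u * norm v" for u v
    using diff[of x u v] by (simp add: q_def algebra_simps)
  have q_bd: "\<bar>q u\<bar> \<le> \<Lambda> * norm u" for u
    using lip[of "x + u" x] by (simp add: q_def)
  have s_bd: "\<bar>s u k\<bar> \<le> \<Lambda> * norm u" for u k
    using q_bd[of "(1 / 2 ^ k) *\<^sub>R u"] by (simp add: s_def abs_mult field_simps)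
  have s_add: "\<bar>s (u + v) k - s u k - s v k\<bar> \<le> C * norm u * norm v * (1 / 2) ^ k" for u v k
  proof -
    have "\<bar>s (u + v) k - s u k - s v k\<bar>
        = 2 ^ k * \<bar>q ((1 / 2 ^ k) *\<^sub>R u + (1 / 2 ^ k) *\<^sub>R v) - q ((1 / 2 ^ k) *\<^sub>R u) - q ((1 / 2 ^ k) *\<^sub>R v)\<bar>"
      by (simp add: s_def scaleR_add_right abs_mult flip: right_diff_distrib)
    also have "\<dots> \<le> 2 ^ k * (C * norm ((1 / 2 ^ k) *\<^sub>R u) * norm ((1 / 2 ^ k) *\<^sub>R v))"
      by (intro mult_left_mono q_add) simp
    finally show ?thesis by (simp add: field_simps power_one_over)
  qed
  have s_step: "\<bar>s u (Suc k) - s u k\<bar> \<le> C * (norm u)\<^sup>2 * (1 / 2) ^ Suc k" for u k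
  proof -
    define v where "v = (1 / 2 ^ Suc k) *\<^sub>R u"
    have "(1 / 2 ^ k) *\<^sub>R u = v + v"
      by (simp add: v_def scaleR_add_left[symmetric])
    then have "s u k = 2 ^ k * q (v + v)" "s u (Suc k) = 2 ^ Suc k * q v"
      by (simp_all only: s_def v_def)
    then have "s u (Suc k) - s u k = - (2 ^ k * (q (v + v) - q v - q v))"
      by (simp add: algebra_simps)
    then have "\<bar>s u (Suc k) - s u k\<bar> = 2 ^ k * \<bar>q (v + v) - q v - q v\<bar>"
      by (simp add: abs_mult)
    also have "\<dots> \<le> 2 ^ k * (C * norm v * norm v)"
      by (intro mult_left_mono q_add) simp
    also have "\<dots> = C * (norm u)\<^sup>2 * (1 / 2) ^ Suc k / 2"
      by (simp add: v_def power2_eq_square field_simps power_one_over)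
    \<comment> \<open>A factor \<open>1 / 2\<close> is given away to reach the terms of
      \<open>power_half_series\<close>, whose sum is 1. Nonnegativity of the bound comes from the
      estimate itself at \<open>u = v\<close>.\<close>
    also have "\<dots> \<le> C * (norm u)\<^sup>2 * (1 / 2) ^ Suc k"
    proof -
      have "0 \<le> C * norm u * norm u" using q_add[of u u] by linarith
      then have "0 \<le> C * (norm u)\<^sup>2 * (1 / 2) ^ Suc k"
        by (simp only: power2_eq_square mult.assoc[symmetric]) simp
      then show ?thesis by linarith
    qed
    finally show ?thesis .
  qed
  \<comment> \<open>The limit is written as its telescoping series started at
    \<open>s u 0 = q u\<close>, so the linearization error is the series itself.\<close>
  define A where "A u = q u + (\<Sum>k. s u (Suc k) - s u k)" for u
  have summable: "summable (\<lambda>k. \<bar>s u (Suc k) - s u k\<bar>)"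
    and sum_bd: "(\<Sum>k. \<bar>s u (Suc k) - s u k\<bar>) \<le> C * (norm u)\<^sup>2" for u
  proof -
    have geo: "(\<lambda>k. C * (norm u)\<^sup>2 * (1 / 2) ^ Suc k) sums (C * (norm u)\<^sup>2)"
      using sums_mult[OF power_half_series, of "C * (norm u)\<^sup>2"] by simp
    show sm: "summable (\<lambda>k. \<bar>s u (Suc k) - s u k\<bar>)"
      by (rule summable_comparison_test'[OF sums_summable[OF geo], where N=0])
        (use s_step in simp)
    show "(\<Sum>k. \<bar>s u (Suc k) - s u k\<bar>) \<le> C * (norm u)\<^sup>2"
      using suminf_le[OF s_step sm sums_summable[OF geo]] sums_unique[OF geo] by simp
  qed
  have lim: "s u \<longlonglongrightarrow> A u" for u
  proof -
    have "(\<lambda>k. s u (Suc k) - s u k) sums (\<Sum>k. s u (Suc k) - s u k)"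
      using summable_rabs_cancel[OF summable] by (rule summable_sums)
    then have "(\<lambda>n. \<Sum>k<n. s u (Suc k) - s u k) \<longlonglongrightarrow> (\<Sum>k. s u (Suc k) - s u k)"
      by (simp add: sums_def)
    then have "(\<lambda>n. s u n - s u 0) \<longlonglongrightarrow> (\<Sum>k. s u (Suc k) - s u k)"
      by (simp add: sum_lessThan_telescope)
    from tendsto_add[OF tendsto_const[of "s u 0"] this]
    have "s u \<longlonglongrightarrow> s u 0 + (\<Sum>k. s u (Suc k) - s u k)" by simp
    moreover have "s u 0 = q u" by (simp add: s_def)
    ultimately show ?thesis by (simp add: A_def)
  qed
  have A_bd: "\<bar>A u\<bar> \<le> \<Lambda> * norm u" for u
    by (rule LIMSEQ_le_const2[OF tendsto_rabs[OF lim]]) (use s_bd in auto)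
  have A_add: "A (u + v) = A u + A v" for u v
  proof -
    have "(\<lambda>k. s (u + v) k - s u k - s v k) \<longlonglongrightarrow> 0"
    proof (rule Lim_null_comparison)
      show "\<forall>\<^sub>F k in sequentially. norm (s (u + v) k - s u k - s v k) \<le> C * norm u * norm v * (1 / 2) ^ k"
        using s_add by simp
      show "(\<lambda>k. C * norm u * norm v * (1 / 2) ^ k) \<longlonglongrightarrow> 0"
        by (intro tendsto_mult_right_zero LIMSEQ_power_zero) simp
    qed
    moreover have "(\<lambda>k. s (u + v) k - s u k - s v k) \<longlonglongrightarrow> A (u + v) - A u - A v"
      by (intro tendsto_diff lim)
    ultimately show ?thesis using LIMSEQ_unique by fastforce
  qed
  show ?thesis
  proof
    show "linear A" by (rule additive_bounded_imp_linear[OF A_add A_bd])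
    show "\<bar>A u\<bar> \<le> \<Lambda> * norm u" for u by (rule A_bd)
    show "\<bar>h (x + u) - h x - A u\<bar> \<le> C * (norm u)\<^sup>2" for u
    proof -
      have "\<bar>h (x + u) - h x - A u\<bar> = \<bar>\<Sum>k. s u (Suc k) - s u k\<bar>"
        by (simp add: A_def q_def)
      also have "\<dots> \<le> (\<Sum>k. \<bar>s u (Suc k) - s u k\<bar>)"
        by (rule summable_rabs[OF summable])
      also note sum_bd
      finally show ?thesis .
    qed
  qed
qed

section \<open>The standard Gaussian measure\<close>

definition gaussian :: "(real ^ 'd) measure" where
  "gaussian = density lborel (\<lambda>z. ennreal (std_gaussian_density z))"

text \<open>\<open>lborel\<close> on vectors is the image of a product measure indexed by
  \<open>Basis\<close>; the bijection \<open>ax\<close> between coordinates and basis vectors turns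
  Fubini for that product into a statement over \<open>UNIV\<close>.\<close>

lemma
  fixes f :: "'d::finite \<Rightarrow> real \<Rightarrow> real"
  assumes f: "\<And>i. integrable lborel (f i)"
  shows integrable_lborel_vec_prod: "integrable lborel (\<lambda>x::real^'d. \<Prod>i\<in>UNIV. f i (x $ i))"
    and integral_lborel_vec_prod:
      "(\<integral>(x::real^'d). (\<Prod>i\<in>UNIV. f i (x $ i)) \<partial>lborel) = (\<Prod>i\<in>UNIV. integral\<^sup>L lborel (f i))"
proof -
  define ax :: "'d \<Rightarrow> real^'d" where "ax i = axis i 1" for i
  have bij: "bij_betw ax UNIV Basis"
    by (auto simp: bij_betw_def inj_on_def ax_def Basis_vec_def axis_eq_axis)
  define F where "F b = f (inv ax b)" for b
  have F: "F (ax i) = f i" for i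
    using bij by (simp add: F_def bij_betw_def inv_f_f)
  have meas: "f i \<in> borel_measurable borel" for i
    using borel_measurable_integrable[OF f] by simp
  interpret product_sigma_finite "\<lambda>_::real^'d. lborel :: real measure" ..
  have Fint: "integrable lborel (F b)" for b
    by (simp add: F_def f)
  define J where "J g = (\<Sum>b\<in>Basis. g b *\<^sub>R b)" for g :: "real^'d \<Rightarrow> real"
  have [measurable]: "J \<in> (\<Pi>\<^sub>M b\<in>Basis. lborel) \<rightarrow>\<^sub>M borel"
    unfolding J_def by measurable
  have comp: "(\<Prod>i\<in>UNIV. f i (J g $ i)) = (\<Prod>b\<in>Basis. F b (g b))" for g
  proof -
    have "J g $ i = g (ax i)" for i
    proof -
      have "J g $ i = J g \<bullet> ax i" by (simp add: ax_def inner_axis)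
      also have "\<dots> = g (ax i)"
        unfolding J_def using bij by (subst inner_sum_left_Basis) (auto simp: bij_betw_def)
      finally show ?thesis .
    qed
    then show ?thesis
      using prod.reindex_bij_betw[OF bij, of "\<lambda>b. F b (g b)"] by (simp add: F)
  qed
  have lb: "(lborel :: (real^'d) measure) = distr (\<Pi>\<^sub>M b\<in>Basis. lborel) borel J"
    unfolding J_def by (rule lborel_eq)
  have [measurable]: "(\<lambda>x::real^'d. \<Prod>i\<in>UNIV. f i (x $ i)) \<in> borel_measurable borel"
    using meas by measurable
  show "integrable lborel (\<lambda>x::real^'d. \<Prod>i\<in>UNIV. f i (x $ i))"
    unfolding lb by (subst integrable_distr_eq)
      (auto simp: comp intro!: product_integrable_prod Fint)
  have "(\<integral>(x::real^'d). (\<Prod>i\<in>UNIV. f i (x $ i)) \<partial>lborel) = (\<Prod>b\<in>Basis. integral\<^sup>L lborel (F b))"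
    unfolding lb by (subst integral_distr)
      (auto simp: comp intro!: product_integral_prod Fint)
  also have "\<dots> = (\<Prod>i\<in>UNIV. integral\<^sup>L lborel (f i))"
    using prod.reindex_bij_betw[OF bij, of "\<lambda>b. integral\<^sup>L lborel (F b)"] by (simp add: F)
  finally show "(\<integral>(x::real^'d). (\<Prod>i\<in>UNIV. f i (x $ i)) \<partial>lborel) = (\<Prod>i\<in>UNIV. integral\<^sup>L lborel (f i))" .
qed

text \<open>This form shows that the density depends on \<open>z\<close> only through
  \<open>norm z\<close>, on which the rotation identity rests.\<close>

lemma std_gaussian_density_eq:
  "std_gaussian_density (z::real^'d) = (1 / sqrt (2 * pi)) ^ CARD('d) * exp (- (norm z)\<^sup>2 / 2)"
proof -
  have "(norm z)\<^sup>2 = (\<Sum>i\<in>UNIV. (z $ i)\<^sup>2)"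
    unfolding power2_norm_eq_inner by (simp add: inner_vec_def power2_eq_square)
  then have "exp (- (norm z)\<^sup>2 / 2) = (\<Prod>i\<in>UNIV. exp (- (z $ i)\<^sup>2 / 2))"
    by (simp add: exp_sum[symmetric] sum_divide_distrib sum_negf)
  then show ?thesis
    by (simp add: std_gaussian_density_def std_normal_density_def prod.distrib prod_constant
      power_one_over prod_dividef)
qed

lemma std_gaussian_density_nonneg: "0 \<le> std_gaussian_density z"
  by (simp add: std_gaussian_density_def prod_nonneg)

lemma borel_measurable_std_gaussian_density [measurable]:
  "std_gaussian_density \<in> borel_measurable borel"
  unfolding std_gaussian_density_eq[abs_def] by measurable

lemma sets_gaussian [measurable_cong, simp]: "sets gaussian = sets borel"
  by (simp add: gaussian_def)

lemma space_gaussian [simp]: "space gaussian = UNIV"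
  by (simp add: gaussian_def)

lemma
  fixes f :: "'d::finite \<Rightarrow> real \<Rightarrow> real"
  assumes f: "\<And>i. integrable lborel (\<lambda>x. std_normal_density x * f i x)"
    and [measurable]: "\<And>i. f i \<in> borel_measurable borel"
  shows integrable_gaussian_prod: "integrable gaussian (\<lambda>z::real^'d. \<Prod>i\<in>UNIV. f i (z $ i))"
    and integral_gaussian_prod:
      "(\<integral>(z::real^'d). (\<Prod>i\<in>UNIV. f i (z $ i)) \<partial>gaussian)
        = (\<Prod>i\<in>UNIV. \<integral>x. std_normal_density x * f i x \<partial>lborel)"
proof -
  have eq: "(\<Prod>i\<in>UNIV. std_normal_density (x $ i) * f i (x $ i))
      = std_gaussian_density x * (\<Prod>i\<in>UNIV. f i (x $ i))" for x :: "real^'d"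
    by (simp add: std_gaussian_density_def prod.distrib)
  show "integrable gaussian (\<lambda>z::real^'d. \<Prod>i\<in>UNIV. f i (z $ i))"
    using integrable_lborel_vec_prod[of "\<lambda>i x. std_normal_density x * f i x", OF f]
    unfolding gaussian_def eq by (subst integrable_density) (auto simp: std_gaussian_density_nonneg)
  show "(\<integral>(z::real^'d). (\<Prod>i\<in>UNIV. f i (z $ i)) \<partial>gaussian)
        = (\<Prod>i\<in>UNIV. \<integral>x. std_normal_density x * f i x \<partial>lborel)"
    using integral_lborel_vec_prod[of "\<lambda>i x. std_normal_density x * f i x", OF f]
    unfolding gaussian_def eq by (subst integral_density) (auto simp: std_gaussian_density_nonneg)
qed

lemma prob_space_gaussian: "prob_space gaussian"
proof -
  have int: "integrable lborel (\<lambda>x. std_normal_density x * 1)"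
    using integrable_std_normal_moment[of 0] by simp
  have "(\<integral>x. std_normal_density x * 1 \<partial>lborel) = 1"
    using integral_std_normal_moment_even[of 0] by simp
  then have "(\<integral>(z::real^'d). (\<Prod>i\<in>(UNIV::'d set). (1::real)) \<partial>gaussian) = 1"
    using integral_gaussian_prod[of "\<lambda>(_::'d) _. 1", OF int] by simp
  then have "measure (gaussian :: (real^'d) measure) UNIV = 1"
    by simp
  then show ?thesis
    by (intro prob_spaceI) (simp add: measure_def enn2real_eq_posreal_iff)
qed

interpretation gaussian: prob_space gaussian
  by (rule prob_space_gaussian)

lemma
  fixes i j :: "'d::finite"
  shows integrable_gaussian_coord2: "integrable gaussian (\<lambda>z::real^'d. z $ i * z $ j)"
    and integral_gaussian_coord2:
      "(\<integral>(z::real^'d). z $ i * z $ j \<partial>gaussian) = (if i = j then 1 else 0)"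
proof -
  \<comment> \<open>Adding two indicators writes \<open>z $ i * z $ j\<close> as one monomial in
    both cases: exponent 2 if \<open>i = j\<close>, two exponents 1 otherwise.\<close>
  define e where "e k = (if k = i then 1 else 0) + (if k = j then 1 else (0::nat))" for k
  have eq: "(\<Prod>k\<in>UNIV. (z $ k) ^ e k) = z $ i * z $ j" for z :: "real^'d"
    by (simp add: e_def power_add prod.distrib if_distrib[of "power _"] cong: if_cong)
  have int: "integrable lborel (\<lambda>x. std_normal_density x * x ^ e k)" for k
    by (rule integrable_std_normal_moment)
  show "integrable gaussian (\<lambda>z::real^'d. z $ i * z $ j)"
    using integrable_gaussian_prod[of "\<lambda>k x. x ^ e k", OF int] by (simp add: eq)
  have "(\<integral>(z::real^'d). z $ i * z $ j \<partial>gaussian)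
      = (\<Prod>k\<in>UNIV. \<integral>x. std_normal_density x * x ^ e k \<partial>lborel)"
    using integral_gaussian_prod[of "\<lambda>k x. x ^ e k", OF int] by (simp add: eq)
  also have "\<dots> = (if i = j then 1 else 0)"
  proof (cases "i = j")
    case True
    have "(\<integral>x. std_normal_density x * x ^ e k \<partial>lborel) = 1" for k
      using integral_std_normal_moment_even[of 0] integral_std_normal_moment_even[of 1] True
      by (auto simp: e_def numeral_2_eq_2)
    then show ?thesis using True by simp
  next
    case False
    have "(\<integral>x. std_normal_density x * x ^ e i \<partial>lborel) = 0"
      using integral_std_normal_moment_odd[of 0] False by (simp add: e_def)
    then show ?thesis using False by (auto intro!: prod_zero)
  qed
  finally show "(\<integral>(z::real^'d). z $ i * z $ j \<partial>gaussian) = (if i = j then 1 else 0)" .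
qed

lemma
  fixes a :: "real^'d"
  shows integrable_gaussian_inner2: "integrable gaussian (\<lambda>z. (a \<bullet> z)\<^sup>2)"
    and integral_gaussian_inner2: "(\<integral>z. (a \<bullet> z)\<^sup>2 \<partial>gaussian) = (norm a)\<^sup>2"
proof -
  have eq: "(a \<bullet> z)\<^sup>2 = (\<Sum>i\<in>UNIV. \<Sum>j\<in>UNIV. (a $ i * a $ j) * (z $ i * z $ j))" for z
    by (simp add: inner_vec_def power2_eq_square sum_product mult_ac)
  show "integrable gaussian (\<lambda>z. (a \<bullet> z)\<^sup>2)"
    unfolding eq by (intro Bochner_Integration.integrable_sum integrable_mult_right integrable_gaussian_coord2)
  have "(\<integral>z. (a \<bullet> z)\<^sup>2 \<partial>gaussian) = (\<Sum>i\<in>UNIV. \<Sum>j\<in>UNIV. (a $ i * a $ j) * (if i = j then 1 else 0))"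
    unfolding eq
    by (simp add: Bochner_Integration.integral_sum Bochner_Integration.integrable_sum
      integrable_gaussian_coord2 integral_gaussian_coord2 cong: if_cong)
  also have "\<dots> = (norm a)\<^sup>2"
    by (simp add: power2_norm_eq_inner inner_vec_def if_distrib cong: if_cong)
  finally show "(\<integral>z. (a \<bullet> z)\<^sup>2 \<partial>gaussian) = (norm a)\<^sup>2" .
qed

text \<open>The square of a quadratic linearization error grows like this power, so its expectation
  must be finite.\<close>

lemma integrable_gaussian_norm4: "integrable gaussian (\<lambda>z::real^'d. norm z ^ 4)"
proof -
  have int: "integrable gaussian (\<lambda>z::real^'d. (z $ i)\<^sup>2 * (z $ j)\<^sup>2)" for i j
  proof -
    define e where "e k = (if k = i then 2 else 0) + (if k = j then 2 else (0::nat))" for k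
    have eq: "(\<Prod>k\<in>UNIV. (z $ k) ^ e k) = (z $ i)\<^sup>2 * (z $ j)\<^sup>2" for z :: "real^'d"
      by (simp add: e_def power_add prod.distrib if_distrib[of "power _"] cong: if_cong)
    have "integrable lborel (\<lambda>x. std_normal_density x * x ^ e k)" for k
      by (rule integrable_std_normal_moment)
    from integrable_gaussian_prod[of "\<lambda>k x. x ^ e k", OF this] show ?thesis by (simp add: eq)
  qed
  have "norm z ^ 4 = (\<Sum>i\<in>UNIV. \<Sum>j\<in>UNIV. (z $ i)\<^sup>2 * (z $ j)\<^sup>2)" for z :: "real^'d"
  proof -
    have "norm z ^ 4 = ((norm z)\<^sup>2)\<^sup>2" by simp
    also have "(norm z)\<^sup>2 = (\<Sum>i\<in>UNIV. (z $ i)\<^sup>2)"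
      unfolding power2_norm_eq_inner by (simp add: inner_vec_def power2_eq_square)
    finally show ?thesis by (simp add: power2_eq_square[of "sum _ _"] sum_product)
  qed
  then show ?thesis
    by (simp add: int)
qed

lemma integrable_gaussian_norm: "integrable gaussian (\<lambda>z::real^'d. norm z)"
proof (rule Bochner_Integration.integrable_bound)
  show "integrable gaussian (\<lambda>z::real^'d. 1 + norm z ^ 4)"
    by (simp add: integrable_gaussian_norm4)
  have "x \<le> 1 + x ^ 4" if "0 \<le> x" for x :: real
  proof (cases "x \<le> 1")
    case False
    then have "x ^ 1 \<le> x ^ 4" by (intro power_increasing) auto
    then show ?thesis by simp
  qed (use that in \<open>simp add: add_increasing2\<close>)
  then show "AE z in gaussian. norm (norm z) \<le> norm (1 + norm (z::real^'d) ^ 4)"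
    by (simp add: abs_of_nonneg)
qed measurable

section \<open>Rotation invariance of pairs of Gaussian vectors\<close>

lemma nn_integral_lborel_affine:
  fixes F :: "'a::euclidean_space \<Rightarrow> ennreal"
  assumes [measurable]: "F \<in> borel_measurable borel" and c: "c \<noteq> 0"
  shows "(\<integral>\<^sup>+x. F x \<partial>lborel) = ennreal (\<bar>c\<bar> ^ DIM('a)) * (\<integral>\<^sup>+x. F (t + c *\<^sub>R x) \<partial>lborel)"
  by (subst lborel_affine[OF c, of t])
    (simp add: nn_integral_density nn_integral_distr nn_integral_cmult)

lemma nn_integral_gaussian:
  fixes F :: "real^'d \<Rightarrow> ennreal"
  assumes [measurable]: "F \<in> borel_measurable borel"
  shows "(\<integral>\<^sup>+z. F z \<partial>gaussian) = (\<integral>\<^sup>+z. ennreal (std_gaussian_density z) * F z \<partial>lborel)"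
  by (simp add: gaussian_def nn_integral_density)

text \<open>Substitute \<open>u = a z + b w\<close> for \<open>z\<close>, and then complete the square in \<open>w\<close>.\<close>

lemma nn_integral_gaussian_rotation:
  fixes F :: "real^'d \<Rightarrow> ennreal"
  assumes F[measurable]: "F \<in> borel_measurable borel" and a: "0 < a" and ab: "a\<^sup>2 + b\<^sup>2 = 1"
  shows "(\<integral>\<^sup>+z. \<integral>\<^sup>+w. F (a *\<^sub>R z + b *\<^sub>R w) \<partial>gaussian \<partial>gaussian) = (\<integral>\<^sup>+u. F u \<partial>gaussian)"
proof -
  let ?g = "\<lambda>z::real^'d. std_gaussian_density z"
  let ?D = "DIM(real^'d)"
  \<comment> \<open>Up to the factor \<open>- 1 / 2\<close>, both exponents equal \<open>((norm
    u)\<^sup>2 - 2 * b * (u \<bullet> w) + (norm w)\<^sup>2) / a\<^sup>2\<close>, which is symmetric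
    in \<open>u\<close> and \<open>w\<close>.\<close>
  have key: "?g ((1 / a) *\<^sub>R (u - b *\<^sub>R w)) * ?g w = ?g u * ?g ((1 / a) *\<^sub>R (w - b *\<^sub>R u))" for u w
  proof -
    have "(norm ((1 / a) *\<^sub>R (u - b *\<^sub>R w)))\<^sup>2 + (norm w)\<^sup>2
        = (norm u)\<^sup>2 + (norm ((1 / a) *\<^sub>R (w - b *\<^sub>R u)))\<^sup>2"
    proof -
      have 1: "(norm (u - b *\<^sub>R w))\<^sup>2 = (norm u)\<^sup>2 - 2 * b * (u \<bullet> w) + b\<^sup>2 * (norm w)\<^sup>2" for u w :: "real^'d"
        unfolding power2_norm_eq_inner
        by (simp add: inner_diff inner_commute power2_eq_square algebra_simps)
      have b: "b\<^sup>2 = 1 - a\<^sup>2" using ab by simp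
      have "(norm (u - b *\<^sub>R w))\<^sup>2 + a\<^sup>2 * (norm w)\<^sup>2 = a\<^sup>2 * (norm u)\<^sup>2 + (norm (w - b *\<^sub>R u))\<^sup>2"
        unfolding 1 b by (simp add: inner_commute algebra_simps)
      then have "((norm (u - b *\<^sub>R w))\<^sup>2 + a\<^sup>2 * (norm w)\<^sup>2) / a\<^sup>2
          = (a\<^sup>2 * (norm u)\<^sup>2 + (norm (w - b *\<^sub>R u))\<^sup>2) / a\<^sup>2" by simp
      then show ?thesis
        using a by (simp add: add_divide_distrib power_mult_distrib power_divide)
    qed
    then have "exp (- (norm ((1 / a) *\<^sub>R (u - b *\<^sub>R w)))\<^sup>2 / 2) * exp (- (norm w)\<^sup>2 / 2)
        = exp (- (norm u)\<^sup>2 / 2) * exp (- (norm ((1 / a) *\<^sub>R (w - b *\<^sub>R u)))\<^sup>2 / 2)"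
      by (simp add: exp_add[symmetric] field_simps)
    then show ?thesis
      unfolding std_gaussian_density_eq by (simp add: mult_ac)
  qed
  have one: "(\<integral>\<^sup>+w. ennreal (?g w) \<partial>lborel) = 1"
  proof -
    have "emeasure (gaussian :: (real^'d) measure) UNIV = 1"
      using prob_space.emeasure_space_1[OF prob_space_gaussian] by (metis space_gaussian)
    then show ?thesis
      using nn_integral_gaussian[of "\<lambda>_::real^'d. 1"] by simp
  qed
  have "(\<integral>\<^sup>+z. \<integral>\<^sup>+w. F (a *\<^sub>R z + b *\<^sub>R w) \<partial>gaussian \<partial>gaussian)
      = (\<integral>\<^sup>+z. \<integral>\<^sup>+w. ennreal (?g z) * (ennreal (?g w) * F (a *\<^sub>R z + b *\<^sub>R w)) \<partial>lborel \<partial>lborel)"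
    by (simp add: nn_integral_gaussian nn_integral_cmult)
  also have "\<dots> = (\<integral>\<^sup>+w. \<integral>\<^sup>+z. ennreal (?g z) * (ennreal (?g w) * F (a *\<^sub>R z + b *\<^sub>R w)) \<partial>lborel \<partial>lborel)"
    by (rule lborel_pair.Fubini') measurable
  also have "\<dots> = (\<integral>\<^sup>+w. ennreal ((1 / a) ^ ?D) *
      (\<integral>\<^sup>+u. ennreal (?g u) * ennreal (?g ((1 / a) *\<^sub>R (w - b *\<^sub>R u))) * F u \<partial>lborel) \<partial>lborel)"
  proof (rule nn_integral_cong)
    fix w :: "real^'d"
    let ?t = "- ((b / a) *\<^sub>R w)"
    have "(\<integral>\<^sup>+z. ennreal (?g z) * (ennreal (?g w) * F (a *\<^sub>R z + b *\<^sub>R w)) \<partial>lborel)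
        = ennreal (\<bar>1 / a\<bar> ^ ?D) * (\<integral>\<^sup>+u. ennreal (?g (?t + (1 / a) *\<^sub>R u)) *
            (ennreal (?g w) * F (a *\<^sub>R (?t + (1 / a) *\<^sub>R u) + b *\<^sub>R w)) \<partial>lborel)"
      using a by (intro nn_integral_lborel_affine) auto
    also have "(\<lambda>u. ennreal (?g (?t + (1 / a) *\<^sub>R u)) *
            (ennreal (?g w) * F (a *\<^sub>R (?t + (1 / a) *\<^sub>R u) + b *\<^sub>R w)))
        = (\<lambda>u. ennreal (?g u) * ennreal (?g ((1 / a) *\<^sub>R (w - b *\<^sub>R u))) * F u)"
    proof
      fix u
      have t: "?t + (1 / a) *\<^sub>R u = (1 / a) *\<^sub>R (u - b *\<^sub>R w)"
        by (simp add: scaleR_diff_right)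
      have "a *\<^sub>R (?t + (1 / a) *\<^sub>R u) + b *\<^sub>R w = u"
        using a by (simp add: t scaleR_diff_right)
      then show "ennreal (?g (?t + (1 / a) *\<^sub>R u)) *
            (ennreal (?g w) * F (a *\<^sub>R (?t + (1 / a) *\<^sub>R u) + b *\<^sub>R w))
        = ennreal (?g u) * ennreal (?g ((1 / a) *\<^sub>R (w - b *\<^sub>R u))) * F u"
        unfolding t mult.assoc[symmetric]
        by (simp add: ennreal_mult'[symmetric] std_gaussian_density_nonneg key)
    qed
    finally show "(\<integral>\<^sup>+z. ennreal (?g z) * (ennreal (?g w) * F (a *\<^sub>R z + b *\<^sub>R w)) \<partial>lborel)
      = ennreal ((1 / a) ^ ?D) *
      (\<integral>\<^sup>+u. ennreal (?g u) * ennreal (?g ((1 / a) *\<^sub>R (w - b *\<^sub>R u))) * F u \<partial>lborel)"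
      using a by simp
  qed
  also have "\<dots> = (\<integral>\<^sup>+w. \<integral>\<^sup>+u. ennreal ((1 / a) ^ ?D) *
      (ennreal (?g u) * ennreal (?g ((1 / a) *\<^sub>R (w - b *\<^sub>R u))) * F u) \<partial>lborel \<partial>lborel)"
    by (simp add: nn_integral_cmult)
  also have "\<dots> = (\<integral>\<^sup>+u. \<integral>\<^sup>+w. ennreal ((1 / a) ^ ?D) *
      (ennreal (?g u) * ennreal (?g ((1 / a) *\<^sub>R (w - b *\<^sub>R u))) * F u) \<partial>lborel \<partial>lborel)"
    by (rule lborel_pair.Fubini') measurable
  \<comment> \<open>For fixed \<open>u\<close> the remaining factor is a Gaussian in
    \<open>w\<close> centred at \<open>b *\<^sub>R u\<close> with scale \<open>a\<close>; the same
    affine substitution, applied to the total mass 1, integrates it.\<close>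
  also have "\<dots> = (\<integral>\<^sup>+u. ennreal (?g u) * F u \<partial>lborel)"
  proof (rule nn_integral_cong)
    fix u :: "real^'d"
    have "(\<integral>\<^sup>+w. ennreal (?g w) \<partial>lborel) = ennreal (\<bar>1 / a\<bar> ^ ?D) *
        (\<integral>\<^sup>+w. ennreal (?g (- ((b / a) *\<^sub>R u) + (1 / a) *\<^sub>R w)) \<partial>lborel)"
      using a by (intro nn_integral_lborel_affine) auto
    also have "(\<lambda>w. - ((b / a) *\<^sub>R u) + (1 / a) *\<^sub>R w) = (\<lambda>w. (1 / a) *\<^sub>R (w - b *\<^sub>R u))"
      by (simp add: fun_eq_iff scaleR_diff_right)
    finally have "1 = ennreal ((1 / a) ^ ?D) * (\<integral>\<^sup>+w. ennreal (?g ((1 / a) *\<^sub>R (w - b *\<^sub>R u))) \<partial>lborel)"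
      using a by (simp add: one)
    moreover have "(\<integral>\<^sup>+w. ennreal ((1 / a) ^ ?D) *
        (ennreal (?g u) * ennreal (?g ((1 / a) *\<^sub>R (w - b *\<^sub>R u))) * F u) \<partial>lborel)
      = (ennreal (?g u) * F u) *
        (ennreal ((1 / a) ^ ?D) * (\<integral>\<^sup>+w. ennreal (?g ((1 / a) *\<^sub>R (w - b *\<^sub>R u))) \<partial>lborel))"
      by (simp add: nn_integral_cmult nn_integral_multc mult_ac)
    ultimately show "(\<integral>\<^sup>+w. ennreal ((1 / a) ^ ?D) *
        (ennreal (?g u) * ennreal (?g ((1 / a) *\<^sub>R (w - b *\<^sub>R u))) * F u) \<partial>lborel)
      = ennreal (?g u) * F u" by simp
  qed
  also have "\<dots> = (\<integral>\<^sup>+u. F u \<partial>gaussian)"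
    by (simp add: nn_integral_gaussian)
  finally show ?thesis .
qed

section \<open>The Gaussian Poincare inequality\<close>

lemma lipschitz_abs_le:
  fixes g :: "'a::real_normed_vector \<Rightarrow> real"
  assumes "\<Lambda>-lipschitz_on UNIV g"
  shows "\<bar>g x - g y\<bar> \<le> \<Lambda> * norm (x - y)"
  using lipschitz_onD[OF assms, of x y] by (simp add: dist_norm)

lemma lipschitz_absI:
  fixes g :: "'a::real_normed_vector \<Rightarrow> real"
  assumes "\<And>x y. \<bar>g x - g y\<bar> \<le> \<Lambda> * norm (x - y)" "0 \<le> \<Lambda>"
  shows "\<Lambda>-lipschitz_on UNIV g"
  using assms by (intro lipschitz_onI) (simp_all add: dist_norm)

lemma lipschitz_borel_measurable:
  fixes g :: "'a::euclidean_space \<Rightarrow> real"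
  assumes "\<Lambda>-lipschitz_on UNIV g"
  shows "g \<in> borel_measurable borel"
  using lipschitz_on_continuous_on[OF assms] by (rule borel_measurable_continuous_onI)

lemma lipschitz_affine:
  fixes g :: "'a::real_normed_vector \<Rightarrow> real"
  assumes g: "\<Lambda>-lipschitz_on UNIV g"
  shows "(\<Lambda> * \<bar>t\<bar>)-lipschitz_on UNIV (\<lambda>w. g (x + t *\<^sub>R w))"
proof (rule lipschitz_absI)
  show "\<bar>g (x + t *\<^sub>R w) - g (x + t *\<^sub>R w')\<bar> \<le> \<Lambda> * \<bar>t\<bar> * norm (w - w')" for w w'
    using lipschitz_abs_le[OF g, of "x + t *\<^sub>R w" "x + t *\<^sub>R w'"]
    by (simp add: scaleR_diff_right[symmetric] mult_ac)
qed (simp add: lipschitz_on_nonneg[OF g])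

lemma lipschitz_integrable:
  fixes g :: "'b::euclidean_space \<Rightarrow> real"
  assumes "prob_space M" and g: "\<Lambda>-lipschitz_on UNIV g"
    and [measurable_cong]: "sets M = sets borel" and norm: "integrable M norm"
  shows "integrable M g"
proof (rule Bochner_Integration.integrable_bound)
  interpret prob_space M by fact
  show "integrable M (\<lambda>z. \<bar>g 0\<bar> + \<Lambda> * norm z)"
    using norm by simp
  show "g \<in> borel_measurable M"
    using lipschitz_borel_measurable[OF g] by simp
  have "norm (g z) \<le> norm (\<bar>g 0\<bar> + \<Lambda> * norm z)" for z
    using lipschitz_abs_le[OF g, of z 0] lipschitz_on_nonneg[OF g] by simp
  then show "AE z in M. norm (g z) \<le> norm (\<bar>g 0\<bar> + \<Lambda> * norm z)" by simp
qed

text \<open>The bound holds for each \<open>w\<close> and survives integration against any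
  probability measure; it serves both Gaussian averaging and the tent kernel.\<close>

lemma lipschitz_average:
  fixes g :: "'b::euclidean_space \<Rightarrow> real"
  assumes "prob_space M" and g: "\<Lambda>-lipschitz_on UNIV g"
    and sets: "sets M = sets borel" and norm: "integrable M norm"
  shows "\<Lambda>-lipschitz_on UNIV (\<lambda>x. \<integral>w. g (x + t *\<^sub>R w) \<partial>M)"
proof (rule lipschitz_absI)
  interpret prob_space M by fact
  have int: "integrable M (\<lambda>w. g (x + t *\<^sub>R w))" for x
    by (rule lipschitz_integrable[OF \<open>prob_space M\<close> lipschitz_affine[OF g] sets norm])
  fix x y
  have "\<bar>(\<integral>w. g (x + t *\<^sub>R w) \<partial>M) - (\<integral>w. g (y + t *\<^sub>R w) \<partial>M)\<bar>
      = \<bar>\<integral>w. g (x + t *\<^sub>R w) - g (y + t *\<^sub>R w) \<partial>M\<bar>"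
    using int by simp
  also have "\<dots> \<le> (\<integral>w. \<bar>g (x + t *\<^sub>R w) - g (y + t *\<^sub>R w)\<bar> \<partial>M)"
    by (rule integral_abs_bound)
  also have "\<dots> \<le> (\<integral>w. \<Lambda> * norm (x - y) \<partial>M)"
  proof (rule integral_mono)
    show "\<bar>g (x + t *\<^sub>R w) - g (y + t *\<^sub>R w)\<bar> \<le> \<Lambda> * norm (x - y)" for w
      using lipschitz_abs_le[OF g, of "x + t *\<^sub>R w" "y + t *\<^sub>R w"] by simp
  qed (use int in auto)
  finally show "\<bar>(\<integral>w. g (x + t *\<^sub>R w) \<partial>M) - (\<integral>w. g (y + t *\<^sub>R w) \<partial>M)\<bar> \<le> \<Lambda> * norm (x - y)"
    by (simp add: prob_space)
qed (rule lipschitz_on_nonneg[OF g])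

text \<open>A Lipschitz gradient expressed without derivatives, so that averaging involves no
  differentiation under the integral.\<close>

definition second_difference_bounded :: "real \<Rightarrow> ('a::real_normed_vector \<Rightarrow> real) \<Rightarrow> bool" where
  "second_difference_bounded C h \<longleftrightarrow>
    (\<forall>x u v. \<bar>h (x + u + v) - h (x + u) - h (x + v) + h x\<bar> \<le> C * norm u * norm v)"

lemma second_difference_bounded_average:
  fixes h :: "'b::euclidean_space \<Rightarrow> real"
  assumes "prob_space M" and h: "\<Lambda>-lipschitz_on UNIV h" "second_difference_bounded C h"
    and sets: "sets M = sets borel" and norm: "integrable M norm"
  shows "second_difference_bounded C (\<lambda>x. \<integral>w. h (x + t *\<^sub>R w) \<partial>M)"
  unfolding second_difference_bounded_def
proof (intro allI)
  interpret prob_space M by fact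
  have int: "integrable M (\<lambda>w. h (x + t *\<^sub>R w))" for x
    by (rule lipschitz_integrable[OF \<open>prob_space M\<close> lipschitz_affine[OF h(1)] sets norm])
  fix x u v
  let ?d = "\<lambda>w. h (x + u + v + t *\<^sub>R w) - h (x + u + t *\<^sub>R w) - h (x + v + t *\<^sub>R w) + h (x + t *\<^sub>R w)"
  have "\<bar>(\<integral>w. h (x + u + v + t *\<^sub>R w) \<partial>M) - (\<integral>w. h (x + u + t *\<^sub>R w) \<partial>M)
      - (\<integral>w. h (x + v + t *\<^sub>R w) \<partial>M) + (\<integral>w. h (x + t *\<^sub>R w) \<partial>M)\<bar> = \<bar>\<integral>w. ?d w \<partial>M\<bar>"
    using int by simp
  also have "\<dots> \<le> (\<integral>w. \<bar>?d w\<bar> \<partial>M)"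
    by (rule integral_abs_bound)
  also have "\<dots> \<le> (\<integral>w. C * norm u * norm v \<partial>M)"
  proof (rule integral_mono)
    show "\<bar>?d w\<bar> \<le> C * norm u * norm v" for w
      using h(2)[unfolded second_difference_bounded_def, rule_format, of "x + t *\<^sub>R w" u v]
      by (simp add: algebra_simps)
  qed (use int in auto)
  finally show "\<bar>(\<integral>w. h (x + u + v + t *\<^sub>R w) \<partial>M) - (\<integral>w. h (x + u + t *\<^sub>R w) \<partial>M)
      - (\<integral>w. h (x + v + t *\<^sub>R w) \<partial>M) + (\<integral>w. h (x + t *\<^sub>R w) \<partial>M)\<bar> \<le> C * norm u * norm v"
    by (simp add: prob_space)
qed

section \<open>Second moments about an arbitrary centre\<close>

text \<open>The mean minimizes the second moment, so a bound about any centre \<open>c\<close>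
  bounds the variance; finiteness of the nonnegative integral gives the integrability.\<close>

lemma (in prob_space)
  assumes [measurable]: "X \<in> borel_measurable M"
    and bd: "(\<integral>\<^sup>+\<omega>. ennreal ((X \<omega> - c)\<^sup>2) \<partial>M) \<le> ennreal B" and B: "0 \<le> B"
  shows second_moment_integrable: "integrable M X"
    and second_moment_integrable2: "integrable M (\<lambda>\<omega>. (X \<omega>)\<^sup>2)"
    and second_moment_variance: "variance X \<le> B"
proof -
  have int2: "integrable M (\<lambda>\<omega>. (X \<omega> - c)\<^sup>2)"
    using bd by (intro integrableI_bounded) (auto simp: le_less_trans)
  then have "integrable M (\<lambda>\<omega>. X \<omega> - c)"
    by (rule square_integrable_imp_integrable[rotated]) measurable
  from Bochner_Integration.integrable_add[OF this integrable_const[of c]]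
  show int1: "integrable M X" by simp
  have "integrable M (\<lambda>\<omega>. (X \<omega> - c)\<^sup>2 + 2 * c * X \<omega> - c\<^sup>2)"
    using int1 int2 by simp
  then show sq: "integrable M (\<lambda>\<omega>. (X \<omega>)\<^sup>2)"
    by (simp add: power2_eq_square algebra_simps)
  have "ennreal (expectation (\<lambda>\<omega>. (X \<omega> - c)\<^sup>2)) \<le> ennreal B"
    using bd by (subst nn_integral_eq_integral[symmetric]) (use int2 in auto)
  then have "expectation (\<lambda>\<omega>. (X \<omega> - c)\<^sup>2) \<le> B"
    using B by (simp add: ennreal_le_iff)
  moreover have "expectation (\<lambda>\<omega>. (X \<omega> - c)\<^sup>2) = variance X + (expectation X - c)\<^sup>2"
    using int1 sq by (subst variance_eq) (auto simp: power2_diff prob_space)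
  ultimately show "variance X \<le> B"
    using zero_le_power2[of "expectation X - c"] by linarith
qed

text \<open>The second moment about \<open>d\<close> is the variance plus the squared distance from
  \<open>d\<close> to the mean, so the unknown \<open>c\<close> drops out.\<close>

lemma (in prob_space) second_moment_shift:
  assumes [measurable]: "X \<in> borel_measurable M"
    and bd: "(\<integral>\<^sup>+\<omega>. ennreal ((X \<omega> - c)\<^sup>2) \<partial>M) \<le> ennreal B" and B: "0 \<le> B"
  shows "(\<integral>\<^sup>+\<omega>. ennreal ((X \<omega> - d)\<^sup>2) \<partial>M) \<le> ennreal (B + (expectation X - d)\<^sup>2)"
proof -
  note int = second_moment_integrable[OF assms] second_moment_integrable2[OF assms]
  have "integrable M (\<lambda>\<omega>. (X \<omega> - d)\<^sup>2)"
    using int by (simp add: power2_diff)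
  then have "(\<integral>\<^sup>+\<omega>. ennreal ((X \<omega> - d)\<^sup>2) \<partial>M) = ennreal (expectation (\<lambda>\<omega>. (X \<omega> - d)\<^sup>2))"
    by (rule nn_integral_eq_integral) simp
  also have "expectation (\<lambda>\<omega>. (X \<omega> - d)\<^sup>2) = variance X + (expectation X - d)\<^sup>2"
    using int by (subst variance_eq) (auto simp: power2_diff prob_space)
  also have "ennreal (variance X + (expectation X - d)\<^sup>2) \<le> ennreal (B + (expectation X - d)\<^sup>2)"
    using second_moment_variance[OF assms] by (intro ennreal_leI add_right_mono)
  finally show ?thesis .
qed

text \<open>The law of total variance for the second moment about an arbitrary centre \<open>d\<close>: only Tonelli's
  theorem is needed, and the mean of \<open>G\<close> never has to be computed.\<close>

lemma two_stage_second_moment: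
  fixes G :: "'a \<Rightarrow> 'b \<Rightarrow> real"
  assumes "prob_space N"
    and G: "\<And>y. y \<in> space M \<Longrightarrow> G y \<in> borel_measurable N"
    and "\<And>y. y \<in> space M \<Longrightarrow> \<exists>c. (\<integral>\<^sup>+z. ennreal ((G y z - c)\<^sup>2) \<partial>N) \<le> ennreal B"
    and [measurable]: "(\<lambda>y. \<integral>z. G y z \<partial>N) \<in> borel_measurable M"
    and M: "prob_space M"
    and B': "(\<integral>\<^sup>+y. ennreal (((\<integral>z. G y z \<partial>N) - d)\<^sup>2) \<partial>M) \<le> ennreal B'"
    and B: "0 \<le> B" "0 \<le> B'"
  shows "(\<integral>\<^sup>+y. \<integral>\<^sup>+z. ennreal ((G y z - d)\<^sup>2) \<partial>N \<partial>M) \<le> ennreal (B + B')"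
proof -
  interpret N: prob_space N by fact
  interpret M: prob_space M by fact
  \<comment> \<open>The centre supplied for the inner integral may depend on \<open>y\<close>;
    moving it to the common \<open>d\<close> leaves the inner mean, to which \<open>B'\<close>
    applies.\<close>
  have "(\<integral>\<^sup>+y. \<integral>\<^sup>+z. ennreal ((G y z - d)\<^sup>2) \<partial>N \<partial>M)
      \<le> (\<integral>\<^sup>+y. ennreal (B + ((\<integral>z. G y z \<partial>N) - d)\<^sup>2) \<partial>M)"
    using N.second_moment_shift[OF G _ B(1)] assms(3) by (intro nn_integral_mono) blast
  also have "\<dots> = ennreal B + (\<integral>\<^sup>+y. ennreal (((\<integral>z. G y z \<partial>N) - d)\<^sup>2) \<partial>M)"
    using B by (simp add: ennreal_plus nn_integral_add M.emeasure_space_1)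
  also have "\<dots> \<le> ennreal B + ennreal B'"
    using B' by (rule add_left_mono)
  finally show ?thesis
    using B by (simp add: ennreal_plus)
qed

text \<open>Young's inequality with a free weight: as \<open>s\<close> tends to 0 the factor on
  \<open>a\<^sup>2\<close> tends to 1, so the leading constant of a variance bound is not
  lost.\<close>

lemma weighted_square_sum_le:
  fixes a b :: real
  assumes "0 < s"
  shows "(a + b)\<^sup>2 \<le> (1 + s) * a\<^sup>2 + (1 + 1 / s) * b\<^sup>2"
proof -
  have "0 \<le> (s * a - b)\<^sup>2 / s" using assms by simp
  also have "\<dots> = s * a\<^sup>2 - 2 * a * b + b\<^sup>2 / s"
    using assms by (simp add: field_simps power2_eq_square)
  finally show ?thesis
    by (simp add: power2_sum algebra_simps)
qed

section \<open>Variance of Lipschitz functions with bounded second differences\<close>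

text \<open>The linear part contributes at most \<open>s\<^sup>2 * \<Lambda>\<^sup>2\<close> and the
  remainder is of order \<open>s\<^sup>2\<close> before squaring. Taking the Young weight equal to
  \<open>s\<close> makes its share of order \<open>s ^ 3\<close>, negligible against
  \<open>s\<^sup>2\<close>.\<close>

lemma gaussian_small_step:
  fixes h :: "real^'d \<Rightarrow> real"
  assumes lip: "\<Lambda>-lipschitz_on UNIV h" and sd: "second_difference_bounded C h" and s: "0 < s"
  shows "(\<integral>\<^sup>+z. ennreal ((h (s *\<^sub>R z) - h 0)\<^sup>2) \<partial>gaussian)
    \<le> ennreal (s\<^sup>2 * ((1 + s) * \<Lambda>\<^sup>2 + (s\<^sup>2 + s) * (C\<^sup>2 * (\<integral>(z::real^'d). norm z ^ 4 \<partial>gaussian))))"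
proof -
  obtain A where A: "linear A" "\<And>u. \<bar>A u\<bar> \<le> \<Lambda> * norm u"
    and err: "\<And>u. \<bar>h (0 + u) - h 0 - A u\<bar> \<le> C * (norm u)\<^sup>2"
    using second_difference_linearization[OF lipschitz_abs_le[OF lip],
        of C 0] sd[unfolded second_difference_bounded_def, rule_format] by blast
  \<comment> \<open>The Riesz vector of \<open>A\<close>; evaluating the bound on \<open>A\<close>
    at \<open>a\<close> itself gives \<open>norm a \<le> \<Lambda>\<close>.\<close>
  define a where "a = adjoint A 1"
  have Aa: "A z = a \<bullet> z" for z
    using adjoint_works[OF A(1), of z 1] by (simp add: a_def inner_commute)
  have "norm a * norm a \<le> \<Lambda> * norm a"
    using A(2)[of a] by (simp add: Aa power2_norm_eq_inner[symmetric] power2_eq_square)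
  then have "norm a \<le> \<Lambda>"
    using lipschitz_on_nonneg[OF lip] by (cases "a = 0") auto
  then have a2: "(norm a)\<^sup>2 \<le> \<Lambda>\<^sup>2" by (simp add: power_mono)
  let ?R = "\<lambda>z::real^'d. (1 + s) * s\<^sup>2 * (a \<bullet> z)\<^sup>2 + (1 + 1 / s) * (C\<^sup>2 * s ^ 4) * norm z ^ 4"
  have pt: "(h (s *\<^sub>R z) - h 0)\<^sup>2 \<le> ?R z" for z
  proof -
    define r where "r = h (s *\<^sub>R z) - h 0 - A (s *\<^sub>R z)"
    have "\<bar>r\<bar> \<le> C * (norm (s *\<^sub>R z))\<^sup>2"
      using err[of "s *\<^sub>R z"] by (simp add: r_def)
    then have "r\<^sup>2 \<le> (C * (norm (s *\<^sub>R z))\<^sup>2)\<^sup>2"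
      by (metis abs_ge_zero power2_abs power_mono)
    also have "\<dots> = C\<^sup>2 * s ^ 4 * norm z ^ 4"
      by (simp add: power_mult_distrib power_mult[symmetric])
    finally have r2: "r\<^sup>2 \<le> C\<^sup>2 * s ^ 4 * norm z ^ 4" .
    have "(h (s *\<^sub>R z) - h 0)\<^sup>2 = (A (s *\<^sub>R z) + r)\<^sup>2" by (simp add: r_def)
    also have "\<dots> \<le> (1 + s) * (A (s *\<^sub>R z))\<^sup>2 + (1 + 1 / s) * r\<^sup>2"
      by (rule weighted_square_sum_le[OF s])
    also have "\<dots> \<le> (1 + s) * (A (s *\<^sub>R z))\<^sup>2 + (1 + 1 / s) * (C\<^sup>2 * s ^ 4 * norm z ^ 4)"
      using r2 s by (intro add_left_mono mult_left_mono) auto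
    also have "\<dots> = ?R z"
      by (simp add: Aa power_mult_distrib mult_ac)
    finally show ?thesis .
  qed
  have Rint: "integrable gaussian ?R"
    by (simp add: integrable_gaussian_inner2 integrable_gaussian_norm4)
  have "(\<integral>\<^sup>+z. ennreal ((h (s *\<^sub>R z) - h 0)\<^sup>2) \<partial>gaussian) \<le> (\<integral>\<^sup>+z. ennreal (?R z) \<partial>gaussian)"
    using pt by (intro nn_integral_mono ennreal_leI) auto
  also have "\<dots> = ennreal (\<integral>z. ?R z \<partial>gaussian)"
    using s by (intro nn_integral_eq_integral Rint) auto
  also have "(\<integral>z. ?R z \<partial>gaussian) = (1 + s) * s\<^sup>2 * (norm a)\<^sup>2
      + (1 + 1 / s) * (C\<^sup>2 * s ^ 4) * (\<integral>(z::real^'d). norm z ^ 4 \<partial>gaussian)"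
    by (simp add: integrable_gaussian_inner2 integrable_gaussian_norm4 integral_gaussian_inner2)
  also have "\<dots> \<le> (1 + s) * s\<^sup>2 * \<Lambda>\<^sup>2
      + (1 + 1 / s) * (C\<^sup>2 * s ^ 4) * (\<integral>(z::real^'d). norm z ^ 4 \<partial>gaussian)"
    using s a2 by (intro add_right_mono mult_left_mono) auto
  also have "(1 + 1 / s) * (C\<^sup>2 * s ^ 4) = s\<^sup>2 * (s\<^sup>2 + s) * C\<^sup>2"
    using s by (simp add: distrib_right distrib_left power2_eq_square power4_eq_xxxx)
  also have "(1 + s) * s\<^sup>2 * \<Lambda>\<^sup>2 + s\<^sup>2 * (s\<^sup>2 + s) * C\<^sup>2 * (\<integral>(z::real^'d). norm z ^ 4 \<partial>gaussian)
      = s\<^sup>2 * ((1 + s) * \<Lambda>\<^sup>2 + (s\<^sup>2 + s) * (C\<^sup>2 * (\<integral>(z::real^'d). norm z ^ 4 \<partial>gaussian)))"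
    by (simp only: distrib_left distrib_right mult_ac)
  finally show ?thesis by (simp add: ennreal_leI)
qed

text \<open>A variance bound at noise scale \<open>s\<close>, uniform over a class closed under
  translation and averaging; this uniformity is what lets scales be composed. The
  \<open>itself\<close> argument fixes the dimension.\<close>

definition gaussian_spread :: "'d::finite itself \<Rightarrow> real \<Rightarrow> real \<Rightarrow> real \<Rightarrow> real \<Rightarrow> bool" where
  "gaussian_spread _ \<Lambda> C s B \<longleftrightarrow> (\<forall>h :: real^'d \<Rightarrow> real.
    \<Lambda>-lipschitz_on UNIV h \<longrightarrow> second_difference_bounded C h \<longrightarrow>
    (\<exists>c. (\<integral>\<^sup>+z. ennreal ((h (s *\<^sub>R z) - c)\<^sup>2) \<partial>gaussian) \<le> ennreal B))"

text \<open>By rotation invariance, independent noises of scales \<open>s\<close> and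
  \<open>t\<close> add up to one of scale \<open>sqrt (s\<^sup>2 + t\<^sup>2)\<close>. With the
  first noise fixed, the second costs \<open>B'\<close>; averaging it out leaves \<open>hb\<close>,
  which lies in the same class and costs \<open>B\<close>.\<close>

lemma gaussian_spread_add:
  assumes S: "gaussian_spread TYPE('d::finite) \<Lambda> C s B"
    and T: "gaussian_spread TYPE('d) \<Lambda> C t B'" and s: "0 < s" and B: "0 \<le> B" "0 \<le> B'"
  shows "gaussian_spread TYPE('d) \<Lambda> C (sqrt (s\<^sup>2 + t\<^sup>2)) (B' + B)"
  unfolding gaussian_spread_def
proof (intro allI impI)
  fix h :: "real^'d \<Rightarrow> real"
  assume h: "\<Lambda>-lipschitz_on UNIV h" "second_difference_bounded C h"
  have [measurable]: "h \<in> borel_measurable borel"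
    by (rule lipschitz_borel_measurable[OF h(1)])
  define r where "r = sqrt (s\<^sup>2 + t\<^sup>2)"
  have r: "0 < r" "r\<^sup>2 = s\<^sup>2 + t\<^sup>2"
    using s by (simp_all add: r_def add_pos_nonneg)
  define hb where "hb x = (\<integral>w. h (x + t *\<^sub>R w) \<partial>gaussian)" for x
  have hb: "\<Lambda>-lipschitz_on UNIV hb" "second_difference_bounded C hb"
    unfolding hb_def using h
    by (intro lipschitz_average[OF prob_space_gaussian] second_difference_bounded_average[OF prob_space_gaussian];
      simp add: integrable_gaussian_norm)+
  have [measurable]: "hb \<in> borel_measurable borel"
    by (rule lipschitz_borel_measurable[OF hb(1)])
  obtain c where c: "(\<integral>\<^sup>+z. ennreal ((hb (s *\<^sub>R z) - c)\<^sup>2) \<partial>gaussian) \<le> ennreal B"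
    using S hb unfolding gaussian_spread_def by blast
  have inner: "\<exists>c. (\<integral>\<^sup>+w. ennreal ((h (s *\<^sub>R z + t *\<^sub>R w) - c)\<^sup>2) \<partial>gaussian) \<le> ennreal B'" for z
  proof -
    have "\<Lambda>-lipschitz_on UNIV (\<lambda>w. h (s *\<^sub>R z + w))"
      using lipschitz_affine[OF h(1), of 1 "s *\<^sub>R z"] by simp
    moreover have "second_difference_bounded C (\<lambda>w. h (s *\<^sub>R z + w))"
      unfolding second_difference_bounded_def
    proof (intro allI)
      fix x u v
      show "\<bar>h (s *\<^sub>R z + (x + u + v)) - h (s *\<^sub>R z + (x + u)) - h (s *\<^sub>R z + (x + v))
          + h (s *\<^sub>R z + x)\<bar> \<le> C * norm u * norm v"
        using h(2)[unfolded second_difference_bounded_def, rule_format, of "s *\<^sub>R z + x" u v]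
        by (simp only: add.assoc)
    qed
    ultimately show ?thesis
      using T unfolding gaussian_spread_def by blast
  qed
  have "(\<integral>\<^sup>+z. \<integral>\<^sup>+w. ennreal ((h (s *\<^sub>R z + t *\<^sub>R w) - c)\<^sup>2) \<partial>gaussian \<partial>gaussian) \<le> ennreal (B' + B)"
    using inner c B prob_space_gaussian
    by (intro two_stage_second_moment) (simp_all flip: hb_def)
  moreover have "(\<integral>\<^sup>+z. \<integral>\<^sup>+w. ennreal ((h (r *\<^sub>R ((s / r) *\<^sub>R z + (t / r) *\<^sub>R w)) - c)\<^sup>2) \<partial>gaussian \<partial>gaussian)
      = (\<integral>\<^sup>+u. ennreal ((h (r *\<^sub>R u) - c)\<^sup>2) \<partial>gaussian)"
    using s r by (intro nn_integral_gaussian_rotation)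
      (auto simp: power_divide add_divide_distrib[symmetric])
  moreover have "r *\<^sub>R ((s / r) *\<^sub>R z + (t / r) *\<^sub>R w) = s *\<^sub>R z + t *\<^sub>R w" for z w :: "real^'d"
    using r by (simp add: scaleR_add_right)
  ultimately have "(\<integral>\<^sup>+u. ennreal ((h (r *\<^sub>R u) - c)\<^sup>2) \<partial>gaussian) \<le> ennreal (B' + B)"
    by simp
  then show "\<exists>c. (\<integral>\<^sup>+z. ennreal ((h (sqrt (s\<^sup>2 + t\<^sup>2) *\<^sub>R z) - c)\<^sup>2) \<partial>gaussian) \<le> ennreal (B' + B)"
    unfolding r_def by blast
qed

lemma gaussian_spread_iterate:
  assumes S: "gaussian_spread TYPE('d::finite) \<Lambda> C s B" and s: "0 < s" and B: "0 \<le> B"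
  shows "gaussian_spread TYPE('d) \<Lambda> C (sqrt (real (Suc n)) * s) (real (Suc n) * B)"
proof (induction n)
  case 0
  then show ?case using S by simp
next
  case (Suc n)
  have "gaussian_spread TYPE('d) \<Lambda> C (sqrt ((sqrt (real (Suc n)) * s)\<^sup>2 + s\<^sup>2)) (B + real (Suc n) * B)"
    using s B by (intro gaussian_spread_add[OF Suc S]) auto
  moreover have "sqrt ((sqrt (real (Suc n)) * s)\<^sup>2 + s\<^sup>2) = sqrt (real (Suc (Suc n))) * s"
  proof -
    have "(sqrt (real (Suc n)) * s)\<^sup>2 + s\<^sup>2 = (sqrt (real (Suc (Suc n))) * s)\<^sup>2"
      by (simp add: power_mult_distrib algebra_simps)
    then show ?thesis using s by (simp only: real_sqrt_abs) simp
  qed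
  ultimately show ?case by (simp add: algebra_simps)
qed

lemma gaussian_variance_smooth:
  fixes h :: "real^'d \<Rightarrow> real"
  assumes lip: "\<Lambda>-lipschitz_on UNIV h" and sd: "second_difference_bounded C h"
  shows "gaussian.variance h \<le> \<Lambda>\<^sup>2"
proof -
  define K where "K = C\<^sup>2 * (\<integral>(z::real^'d). norm z ^ 4 \<partial>gaussian)"
  have K: "0 \<le> K" by (simp add: K_def)
  define s where "s n = 1 / sqrt (real (Suc n))" for n
  have s: "0 < s n" "real (Suc n) * (s n)\<^sup>2 = 1" "sqrt (real (Suc n)) * s n = 1" for n
    by (simp_all add: s_def power_divide)
  \<comment> \<open>The cost at scale \<open>s n\<close> per unit of noise variance:
    \<open>n + 1\<close> steps of squared scale \<open>1 / (n + 1)\<close> add up to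
    \<open>e n\<close>, which tends to \<open>\<Lambda>\<^sup>2\<close>.\<close>
  define e where "e n = (1 + s n) * \<Lambda>\<^sup>2 + ((s n)\<^sup>2 + s n) * K" for n
  have e: "0 \<le> e n" for n
    using s(1)[of n] K by (simp add: e_def)
  have "gaussian.variance h \<le> e n" for n
  proof -
    have "gaussian_spread TYPE('d) \<Lambda> C (s n) ((s n)\<^sup>2 * e n)"
      unfolding gaussian_spread_def e_def K_def
      using gaussian_small_step[OF _ _ s(1)] by blast
    from gaussian_spread_iterate[OF this s(1), of n] e[of n]
    have "gaussian_spread TYPE('d) \<Lambda> C (sqrt (real (Suc n)) * s n) (real (Suc n) * (s n)\<^sup>2 * e n)"
      by (simp only: mult.assoc) simp
    then have "gaussian_spread TYPE('d) \<Lambda> C 1 (e n)"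
      by (simp only: s mult_1_left)
    then obtain c where c: "(\<integral>\<^sup>+z. ennreal ((h z - c)\<^sup>2) \<partial>gaussian) \<le> ennreal (e n)"
      unfolding gaussian_spread_def using lip sd by force
    show ?thesis
      by (rule gaussian.second_moment_variance[OF _ c e])
        (use lipschitz_borel_measurable[OF lip] in simp)
  qed
  moreover have "e \<longlonglongrightarrow> (1 + 0) * \<Lambda>\<^sup>2 + (0\<^sup>2 + 0) * K"
  proof -
    have "(\<lambda>n. inverse (sqrt (real (Suc n)))) \<longlonglongrightarrow> 0"
      by (intro tendsto_inverse_0_at_top filterlim_compose[OF sqrt_at_top]
        filterlim_compose[OF filterlim_real_sequentially filterlim_Suc])
    then have "s \<longlonglongrightarrow> 0"
      by (simp add: s_def[abs_def] inverse_eq_divide)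
    then show ?thesis unfolding e_def by (intro tendsto_intros)
  qed
  ultimately show ?thesis
    using LIMSEQ_le_const[of e "\<Lambda>\<^sup>2" "gaussian.variance h"] by simp
qed

section \<open>Mollification by a tent kernel\<close>

text \<open>A Lipschitz kernel with compact support suffices: in a second difference of the
  convolution, one difference falls on the function and the other on the kernel.\<close>

definition tent :: "'a::euclidean_space \<Rightarrow> real" where
  "tent y = max 0 (1 - norm y)"

lemma tent_nonneg: "0 \<le> tent y" and tent_le_indicator: "tent y \<le> indicator (cball 0 1) y"
  by (auto simp: tent_def indicator_def)

lemma borel_measurable_tent [measurable]: "tent \<in> borel_measurable borel"
  unfolding tent_def[abs_def] by measurable

lemma integrable_indicator_cball: "integrable lborel (indicat_real (cball (a::'a::euclidean_space) r))"
  by (intro integrable_real_indicator) (use emeasure_bounded_finite[OF bounded_cball, of a r] in auto)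

lemma integrable_tent: "integrable lborel (tent :: 'a::euclidean_space \<Rightarrow> real)"
  by (rule Bochner_Integration.integrable_bound[OF integrable_indicator_cball[of 0 1]])
    (auto intro!: always_eventually simp: abs_of_nonneg[OF tent_nonneg] tent_le_indicator)

lemma integral_tent_pos: "0 < (\<integral>y. tent (y::'a::euclidean_space) \<partial>lborel)"
proof -
  have "1 / 2 * indicat_real (cball (0::'a) (1 / 2)) y \<le> tent y" for y
    by (auto simp: tent_def indicator_def)
  then have "(\<integral>y. 1 / 2 * indicat_real (cball (0::'a) (1 / 2)) y \<partial>lborel) \<le> (\<integral>y. tent (y::'a) \<partial>lborel)"
    by (intro integral_mono integrable_tent integrable_mult_right integrable_indicator_cball) auto
  moreover have "(\<integral>y. 1 / 2 * indicat_real (cball (0::'a) (1 / 2)) y \<partial>lborel)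
      = 1 / 2 * measure lborel (cball (0::'a) (1 / 2))"
    by simp
  moreover have "0 < measure lborel (cball (0::'a) (1 / 2))"
    by (intro content_cball_pos) simp
  ultimately show ?thesis by linarith
qed

lemma tent_diff_le:
  "\<bar>tent (y - w) - tent y\<bar> \<le> norm w * (indicator (cball 0 1) y + indicator (cball w 1) y)"
proof (cases "y \<in> cball 0 1 \<or> y \<in> cball w 1")
  case True
  then have "1 \<le> indicator (cball 0 1) y + indicat_real (cball w 1) y"
    by (auto simp: indicator_def)
  moreover have "\<bar>tent (y - w) - tent y\<bar> \<le> norm w"
    using norm_triangle_ineq3[of "y - w" y] by (simp add: tent_def)
  ultimately show ?thesis
    using mult_left_mono[of 1 "indicator (cball 0 1) y + indicat_real (cball w 1) y" "norm w"] by simp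
next
  case False
  then show ?thesis by (simp add: tent_def dist_norm norm_minus_commute)
qed

text \<open>The difference along \<open>u\<close> falls on \<open>g\<close> and is at most
  \<open>\<Lambda> * norm u\<close>; the one along \<open>v\<close> is moved onto the kernel by
  translation. The resulting \<open>C\<close> grows like \<open>1 / \<delta>\<close>, which is
  harmless because the variance bound \<open>\<Lambda>\<^sup>2\<close> for such \<open>h\<close>
  does not involve \<open>C\<close>.\<close>

lemma lipschitz_smooth_approximation:
  fixes g :: "'a::euclidean_space \<Rightarrow> real"
  assumes g: "\<Lambda>-lipschitz_on UNIV g" and \<delta>: "0 < \<delta>"
  obtains h C where "\<Lambda>-lipschitz_on UNIV h" "second_difference_bounded C h"
    "\<And>x. \<bar>h x - g x\<bar> \<le> \<Lambda> * \<delta>"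
proof -
  define c where "c = (\<integral>y. tent (y::'a) \<partial>lborel)"
  have c: "0 < c" unfolding c_def by (rule integral_tent_pos)
  define K where "K y = tent y / c" for y :: 'a
  have [measurable]: "K \<in> borel_measurable borel" unfolding K_def[abs_def] by measurable
  have K_nonneg: "0 \<le> K y" for y using c tent_nonneg[of y] by (simp add: K_def)
  have K_int: "integrable lborel K"
    unfolding K_def[abs_def] by (simp add: integrable_tent)
  have K_one: "(\<integral>y. K y \<partial>lborel) = 1"
    using c by (simp add: K_def c_def)
  define \<kappa> where "\<kappa> = density lborel (\<lambda>y. ennreal (K y))"
  have sets: "sets \<kappa> = sets borel" by (simp add: \<kappa>_def)
  have "emeasure \<kappa> (space \<kappa>) = (\<integral>\<^sup>+y. ennreal (K y) \<partial>lborel)"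
    by (simp add: \<kappa>_def emeasure_density)
  also have "\<dots> = 1"
    using nn_integral_eq_integral[OF K_int] K_nonneg K_one by simp
  finally have prob: "prob_space \<kappa>" by (rule prob_spaceI)
  interpret \<kappa>: prob_space \<kappa> by (rule prob)
  have AE1: "AE y in \<kappa>. norm y \<le> 1"
    unfolding \<kappa>_def by (subst AE_density) (auto simp: K_def tent_def ennreal_eq_0_iff)
  have norm: "integrable \<kappa> norm"
    by (rule \<kappa>.integrable_const_bound[of _ 1]) (use AE1 in \<open>auto simp: sets cong: measurable_cong_sets\<close>)
  have to_lborel: "(\<integral>y. F y \<partial>\<kappa>) = (\<integral>y. K y * F y \<partial>lborel)"
    if "F \<in> borel_measurable borel" for F :: "'a \<Rightarrow> real"
    unfolding \<kappa>_def using that K_nonneg by (subst integral_density) auto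
  define h where "h x = (\<integral>w. g (x + \<delta> *\<^sub>R w) \<partial>\<kappa>)" for x
  have int: "integrable \<kappa> (\<lambda>w. g (x + \<delta> *\<^sub>R w))" for x
    by (rule lipschitz_integrable[OF prob lipschitz_affine[OF g] sets norm])
  define V where "V = measure lborel (cball (0::'a) 1)"
  \<comment> \<open>\<open>2 * V\<close> is the integral of the two ball indicators,
    \<open>c\<close> normalizes the tent, and \<open>1 / \<delta>\<close> comes from rescaling
    \<open>v\<close> to \<open>w\<close>.\<close>
  define C where "C = \<Lambda> * (2 * V / (c * \<delta>))"
  show ?thesis
  proof
    show "\<Lambda>-lipschitz_on UNIV h"
      unfolding h_def by (rule lipschitz_average[OF prob g sets norm])
    show "\<bar>h x - g x\<bar> \<le> \<Lambda> * \<delta>" for x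
    proof -
      have "\<bar>h x - g x\<bar> = \<bar>\<integral>w. g (x + \<delta> *\<^sub>R w) - g x \<partial>\<kappa>\<bar>"
        using int[of x] by (simp add: h_def \<kappa>.prob_space)
      also have "\<dots> \<le> (\<integral>w. \<bar>g (x + \<delta> *\<^sub>R w) - g x\<bar> \<partial>\<kappa>)"
        by (rule integral_abs_bound)
      also have "\<dots> \<le> (\<integral>w. \<Lambda> * \<delta> \<partial>\<kappa>)"
      proof (rule integral_mono_AE)
        show "AE w in \<kappa>. \<bar>g (x + \<delta> *\<^sub>R w) - g x\<bar> \<le> \<Lambda> * \<delta>"
          using AE1
        proof eventually_elim
          fix w :: 'a assume w: "norm w \<le> 1"
          have "\<bar>g (x + \<delta> *\<^sub>R w) - g x\<bar> \<le> \<Lambda> * (\<delta> * norm w)"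
            using lipschitz_abs_le[OF g, of "x + \<delta> *\<^sub>R w" x] \<delta> by simp
          also have "\<dots> \<le> \<Lambda> * (\<delta> * 1)"
            using w \<delta> lipschitz_on_nonneg[OF g] by (intro mult_left_mono) auto
          finally show "\<bar>g (x + \<delta> *\<^sub>R w) - g x\<bar> \<le> \<Lambda> * \<delta>" by simp
        qed
      qed (use int[of x] in auto)
      finally show ?thesis by (simp add: \<kappa>.prob_space)
    qed
    show "second_difference_bounded C h"
      unfolding second_difference_bounded_def
    proof (intro allI)
      fix x u v :: 'a
      define D where "D y = g (x + u + \<delta> *\<^sub>R y) - g (x + \<delta> *\<^sub>R y)" for y
      define w where "w = (1 / \<delta>) *\<^sub>R v"
      have [measurable]: "g \<in> borel_measurable borel" by (rule lipschitz_borel_measurable[OF g])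
      have [measurable]: "D \<in> borel_measurable borel" unfolding D_def by measurable
      have D_bd: "\<bar>D y\<bar> \<le> \<Lambda> * norm u" for y
        using lipschitz_abs_le[OF g, of "x + u + \<delta> *\<^sub>R y" "x + \<delta> *\<^sub>R y"] by (simp add: D_def)
      have D_shift: "D (w + y) = g (x + u + v + \<delta> *\<^sub>R y) - g (x + v + \<delta> *\<^sub>R y)" for y
        using \<delta> by (simp add: D_def w_def scaleR_add_right add_ac)
      have h1: "h (x + u) - h x = (\<integral>y. K y * D y \<partial>lborel)"
        using int by (simp add: to_lborel[symmetric] h_def D_def)
      have h2: "h (x + u + v) - h (x + v) = (\<integral>y. K y * D (w + y) \<partial>lborel)"
        using int by (subst to_lborel[symmetric]) (simp_all add: h_def D_shift)
      have h3: "(\<integral>y. K y * D (w + y) \<partial>lborel) = (\<integral>y. K (y - w) * D y \<partial>lborel)"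
      proof -
        have "(\<integral>y. K (y - w) * D y \<partial>lborel) = (\<integral>y. K (y - w) * D y \<partial>distr lborel borel ((+) w))"
          by (simp add: lborel_distr_plus)
        also have "\<dots> = (\<integral>y. K y * D (w + y) \<partial>lborel)"
          by (subst integral_distr) auto
        finally show ?thesis by simp
      qed
      have Ksh_int: "integrable lborel (\<lambda>y. K (y - w))"
      proof -
        have "integrable (distr lborel borel ((+) w)) (\<lambda>y. K (y - w))"
          by (subst integrable_distr_eq) (use K_int in auto)
        then show ?thesis by (simp add: lborel_distr_plus)
      qed
      have KD_int: "integrable lborel (\<lambda>y. k y * D y)" if k: "integrable lborel k" for k :: "'a \<Rightarrow> real"
      proof (rule Bochner_Integration.integrable_bound)
        show "integrable lborel (\<lambda>y. (\<Lambda> * norm u) * k y)" using k by simp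
        show "(\<lambda>y. k y * D y) \<in> borel_measurable lborel"
          using borel_measurable_integrable[OF k] by measurable
        have "\<bar>k y\<bar> * \<bar>D y\<bar> \<le> \<bar>k y\<bar> * \<bar>\<Lambda> * norm u\<bar>" for y
          using D_bd[of y] by (intro mult_left_mono) auto
        then show "AE y in lborel. norm (k y * D y) \<le> norm ((\<Lambda> * norm u) * k y)"
          by (simp add: abs_mult mult_ac)
      qed
      let ?I = "\<lambda>y. indicat_real (cball 0 1) y + indicator (cball w 1) y"
      have "\<bar>h (x + u + v) - h (x + u) - h (x + v) + h x\<bar>
          = \<bar>(h (x + u + v) - h (x + v)) - (h (x + u) - h x)\<bar>" by (simp add: algebra_simps)
      also have "\<dots> = \<bar>\<integral>y. (K (y - w) - K y) * D y \<partial>lborel\<bar>"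
        unfolding h1 h2 h3 using KD_int[OF K_int] KD_int[OF Ksh_int]
        by (simp add: left_diff_distrib)
      also have "\<dots> \<le> (\<integral>y. \<bar>(K (y - w) - K y) * D y\<bar> \<partial>lborel)"
        by (rule integral_abs_bound)
      also have "\<dots> \<le> (\<integral>y. (norm w / c * (\<Lambda> * norm u)) * ?I y \<partial>lborel)"
      proof (rule integral_mono)
        show "integrable lborel (\<lambda>y. \<bar>(K (y - w) - K y) * D y\<bar>)"
          by (intro integrable_abs KD_int Bochner_Integration.integrable_diff K_int Ksh_int)
        show "integrable lborel (\<lambda>y. (norm w / c * (\<Lambda> * norm u)) * ?I y)"
          by (intro integrable_mult_right Bochner_Integration.integrable_add integrable_indicator_cball)
        fix y
        have "\<bar>K (y - w) - K y\<bar> = \<bar>tent (y - w) - tent y\<bar> / c"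
          using c by (simp add: K_def diff_divide_distrib[symmetric])
        also have "\<dots> \<le> norm w * ?I y / c"
          using tent_diff_le[of y w] c by (intro divide_right_mono) auto
        finally have "\<bar>K (y - w) - K y\<bar> * \<bar>D y\<bar> \<le> (norm w * ?I y / c) * (\<Lambda> * norm u)"
          using D_bd[of y] c by (intro mult_mono) auto
        then show "\<bar>(K (y - w) - K y) * D y\<bar> \<le> (norm w / c * (\<Lambda> * norm u)) * ?I y"
          by (simp add: abs_mult mult_ac)
      qed
      also have "\<dots> = (norm w / c * (\<Lambda> * norm u)) * (\<integral>y. ?I y \<partial>lborel)"
        by (rule integral_mult_right_zero)
      also have "(\<integral>y. ?I y \<partial>lborel) = measure lborel (cball (0::'a) 1) + measure lborel (cball w 1)"
        by (subst Bochner_Integration.integral_add) (auto intro: integrable_indicator_cball)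
      also have "measure lborel (cball w 1) = V"
      proof -
        have "cball w 1 = (+) w ` cball 0 1" by (simp add: cball_translation)
        then have "measure lebesgue (cball w 1) = measure lebesgue (cball (0::'a) 1)"
          by (simp only: measure_translation)
        then show ?thesis by (simp add: V_def measure_completion)
      qed
      also have "norm w / c * (\<Lambda> * norm u) * (measure lborel (cball (0::'a) 1) + V) = C * norm u * norm v"
        using \<delta> c by (simp add: V_def[symmetric] w_def C_def field_simps)
      finally show "\<bar>h (x + u + v) - h (x + u) - h (x + v) + h x\<bar> \<le> C * norm u * norm v" .
    qed
  qed
qed

lemma
  fixes g :: "real^'d \<Rightarrow> real"
  assumes g: "\<Lambda>-lipschitz_on UNIV g"
  shows integrable_gaussian_lipschitz: "integrable gaussian g"
    and integrable_gaussian_lipschitz2: "integrable gaussian (\<lambda>z. (g z)\<^sup>2)"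
proof -
  have [measurable]: "g \<in> borel_measurable borel" by (rule lipschitz_borel_measurable[OF g])
  show "integrable gaussian g"
    by (rule lipschitz_integrable[OF prob_space_gaussian g]) (simp_all add: integrable_gaussian_norm)
  show "integrable gaussian (\<lambda>z. (g z)\<^sup>2)"
  proof (rule Bochner_Integration.integrable_bound)
    show "integrable gaussian (\<lambda>z::real^'d. 2 * (g 0)\<^sup>2 + 2 * \<Lambda>\<^sup>2 * (1 + norm z ^ 4))"
      by (simp add: integrable_gaussian_norm4)
    have "(g z)\<^sup>2 \<le> 2 * (g 0)\<^sup>2 + 2 * \<Lambda>\<^sup>2 * (1 + norm z ^ 4)" for z
    proof -
      have "\<bar>g z - g 0\<bar>\<^sup>2 \<le> (\<Lambda> * norm z)\<^sup>2"
        using lipschitz_abs_le[OF g, of z 0] by (intro power_mono) auto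
      moreover have "(g z)\<^sup>2 \<le> 2 * (g 0)\<^sup>2 + 2 * (g z - g 0)\<^sup>2"
        using weighted_square_sum_le[of 1 "g 0" "g z - g 0"] by simp
      moreover have "(norm z)\<^sup>2 \<le> 1 + norm z ^ 4"
      proof -
        \<comment> \<open>Expands to
          \<open>(norm z)\<^sup>2 \<le> norm z ^ 4 + 1 / 4\<close>.\<close>
        have "0 \<le> (2 * (norm z)\<^sup>2 - 1)\<^sup>2" by simp
        then show ?thesis by (simp add: power2_diff power_mult_distrib power_mult[symmetric])
      qed
      then have "\<Lambda>\<^sup>2 * (norm z)\<^sup>2 \<le> \<Lambda>\<^sup>2 * (1 + norm z ^ 4)"
        by (rule mult_left_mono) simp
      ultimately show ?thesis by (simp add: power_mult_distrib)
    qed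
    then show "AE z in gaussian. norm ((g z)\<^sup>2) \<le> norm (2 * (g 0)\<^sup>2 + 2 * \<Lambda>\<^sup>2 * (1 + norm z ^ 4))"
      by (intro always_eventually allI) (simp add: abs_of_nonneg)
  qed simp
qed

lemma measure_gaussian_UNIV: "measure (gaussian :: (real^'d) measure) UNIV = 1"
  by (metis prob_space.prob_space prob_space_gaussian space_gaussian)

text \<open>The Young weight is taken equal to the mollification radius \<open>\<delta>\<close>: the
  error \<open>(1 + 1 / \<delta>) * (\<Lambda> * \<delta>)\<^sup>2\<close> is then of order
  \<open>\<delta>\<close> and vanishes in the limit. The deviation of \<open>g\<close> is measured
  from the mean of the mollified \<open>h\<close>.\<close>

lemma gaussian_poincare_lipschitz:
  fixes g :: "real^'d \<Rightarrow> real"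
  assumes g: "\<Lambda>-lipschitz_on UNIV g"
  shows "gaussian.variance g \<le> \<Lambda>\<^sup>2"
proof -
  have [measurable]: "g \<in> borel_measurable borel" by (rule lipschitz_borel_measurable[OF g])
  have "gaussian.variance g \<le> (1 + \<delta>) * \<Lambda>\<^sup>2 + (1 + 1 / \<delta>) * (\<Lambda> * \<delta>)\<^sup>2" if \<delta>: "0 < \<delta>" for \<delta>
  proof -
    obtain h C where h: "\<Lambda>-lipschitz_on UNIV h" "second_difference_bounded C h"
      and hg: "\<And>x. \<bar>h x - g x\<bar> \<le> \<Lambda> * \<delta>"
      using lipschitz_smooth_approximation[OF g \<delta>] by blast
    define c where "c = gaussian.expectation h"
    have int: "integrable gaussian (\<lambda>z. (h z - c)\<^sup>2)"
      using integrable_gaussian_lipschitz[OF h(1)] integrable_gaussian_lipschitz2[OF h(1)]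
      by (simp add: power2_diff)
    let ?R = "\<lambda>z. (1 + \<delta>) * (h z - c)\<^sup>2 + (1 + 1 / \<delta>) * (\<Lambda> * \<delta>)\<^sup>2"
    have "(g z - c)\<^sup>2 \<le> ?R z" for z
    proof -
      have "\<bar>g z - h z\<bar>\<^sup>2 \<le> (\<Lambda> * \<delta>)\<^sup>2"
        using hg[of z] by (intro power_mono) auto
      then have "(1 + 1 / \<delta>) * (g z - h z)\<^sup>2 \<le> (1 + 1 / \<delta>) * (\<Lambda> * \<delta>)\<^sup>2"
        using \<delta> by (intro mult_left_mono) auto
      then show ?thesis
        using weighted_square_sum_le[OF \<delta>, of "h z - c" "g z - h z"] by simp
    qed
    then have "(\<integral>\<^sup>+z. ennreal ((g z - c)\<^sup>2) \<partial>gaussian) \<le> (\<integral>\<^sup>+z. ennreal (?R z) \<partial>gaussian)"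
      by (intro nn_integral_mono ennreal_leI) auto
    also have "\<dots> = ennreal (\<integral>z. ?R z \<partial>gaussian)"
      using \<delta> int by (intro nn_integral_eq_integral) auto
    also have "(\<integral>z. ?R z \<partial>gaussian) = (1 + \<delta>) * gaussian.variance h + (1 + 1 / \<delta>) * (\<Lambda> * \<delta>)\<^sup>2"
      using int by (simp add: c_def[symmetric] measure_gaussian_UNIV)
    also have "\<dots> \<le> (1 + \<delta>) * \<Lambda>\<^sup>2 + (1 + 1 / \<delta>) * (\<Lambda> * \<delta>)\<^sup>2"
      using \<delta> gaussian_variance_smooth[OF h] by (intro add_right_mono mult_left_mono) auto
    finally have "(\<integral>\<^sup>+z. ennreal ((g z - c)\<^sup>2) \<partial>gaussian)
        \<le> ennreal ((1 + \<delta>) * \<Lambda>\<^sup>2 + (1 + 1 / \<delta>) * (\<Lambda> * \<delta>)\<^sup>2)"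
      by (simp add: ennreal_leI)
    then show ?thesis
      by (rule gaussian.second_moment_variance[rotated]) (use \<delta> in auto)
  qed
  moreover have "(1 + 1 / \<delta>) * (\<Lambda> * \<delta>)\<^sup>2 = (\<delta>\<^sup>2 + \<delta>) * \<Lambda>\<^sup>2" if "0 < \<delta>" for \<delta>
    using that by (simp add: field_simps power2_eq_square)
  ultimately have bd: "gaussian.variance g \<le> (1 + \<delta>) * \<Lambda>\<^sup>2 + (\<delta>\<^sup>2 + \<delta>) * \<Lambda>\<^sup>2" if "0 < \<delta>" for \<delta>
    using that by metis
  have "((\<lambda>\<delta>. (1 + \<delta>) * \<Lambda>\<^sup>2 + (\<delta>\<^sup>2 + \<delta>) * \<Lambda>\<^sup>2) \<longlongrightarrow> (1 + 0) * \<Lambda>\<^sup>2 + (0\<^sup>2 + 0) * \<Lambda>\<^sup>2) (at_right 0)"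
    by (intro tendsto_intros)
  moreover have "\<forall>\<^sub>F \<delta> in at_right 0. gaussian.variance g \<le> (1 + \<delta>) * \<Lambda>\<^sup>2 + (\<delta>\<^sup>2 + \<delta>) * \<Lambda>\<^sup>2"
    using eventually_at_right_less[of 0] by eventually_elim (rule bd)
  ultimately show ?thesis
    using tendsto_lowerbound[of _ _ "at_right (0::real)" "gaussian.variance g"] by fastforce
qed

section \<open>Variance propagation along the chain\<close>

lemma gaussian_lipschitz_second_moment:
  fixes g :: "real^'d \<Rightarrow> real"
  assumes g: "\<Lambda>-lipschitz_on UNIV g"
  shows "(\<integral>\<^sup>+z. ennreal ((g z - gaussian.expectation g)\<^sup>2) \<partial>gaussian) \<le> ennreal (\<Lambda>\<^sup>2)"
proof -
  have "integrable gaussian (\<lambda>z. (g z - gaussian.expectation g)\<^sup>2)"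
    using integrable_gaussian_lipschitz[OF g] integrable_gaussian_lipschitz2[OF g]
    by (simp add: power2_diff)
  from nn_integral_eq_integral[OF this] show ?thesis
    using gaussian_poincare_lipschitz[OF g] by (simp add: ennreal_leI)
qed

text \<open>The upper and lower quadratic bounds are compared at a unit vector, which exists because
  the index type is nonempty.\<close>

lemma smooth_imp_convexity_le_lipschitz:
  fixes U :: "real^'d \<Rightarrow> real"
  assumes grad: "\<And>y. GDERIV U y :> gradU y"
    and lip: "\<And>y z. norm (gradU y - gradU z) \<le> L * norm (y - z)"
    and conv: "\<And>y z. U z \<ge> U y + gradU y \<bullet> (z - y) + (m / 2) * (norm (y - z))\<^sup>2"
  shows "m \<le> L"
proof -
  obtain i :: 'd where True by blast
  define e :: "real^'d" where "e = axis i 1"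
  have "norm e = 1" by (simp add: e_def)
  then show ?thesis
    using descent_lemma[OF grad lip, of e 0] conv[of 0 e] by simp
qed

text \<open>The given constant \<open>C\<close> bounds the set of quotients, so that the real
  \<open>Sup\<close> is a genuine supremum.\<close>

lemma abs_diff_le_lip_norm:
  fixes f :: "'a::real_normed_vector \<Rightarrow> real"
  assumes "C-lipschitz_on UNIV f"
  shows "\<bar>f x - f y\<bar> \<le> lip_norm f * norm (x - y)"
proof (cases "x = y")
  case False
  have "\<bar>f x - f y\<bar> / norm (x - y) \<le> lip_norm f"
    unfolding lip_norm_def
  proof (rule cSup_upper)
    show "bdd_above {\<bar>f x - f y\<bar> / norm (x - y) |x y. x \<noteq> y}"
      using lipschitz_abs_le[OF assms] by (auto intro!: bdd_aboveI[of _ C] simp: divide_le_eq)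
  qed (use False in auto)
  then show ?thesis using False by (simp add: divide_le_eq)
qed simp

lemma lip_norm_lipschitz:
  fixes f :: "'a::euclidean_space \<Rightarrow> real"
  assumes f: "C-lipschitz_on UNIV f"
  shows "(lip_norm f)-lipschitz_on UNIV f"
proof (rule lipschitz_absI)
  obtain b :: 'a where "b \<in> Basis" using nonempty_Basis by blast
  then have "0 \<le> lip_norm f * norm (b - 0)"
    using abs_diff_le_lip_norm[OF f, of b 0] by linarith
  then show "0 \<le> lip_norm f" using \<open>b \<in> Basis\<close> by simp
qed (rule abs_diff_le_lip_norm[OF f])

section \<open>The chain as a function of its noise path\<close>

text \<open>Here a sample point is itself the noise sequence, which makes the chain a measurable
  function of finitely many noises.\<close>

abbreviation ula_path :: "(real^'d \<Rightarrow> real^'d) \<Rightarrow> (nat \<Rightarrow> real) \<Rightarrow> real^'d \<Rightarrow> nat \<Rightarrow> (nat \<Rightarrow> real^'d) \<Rightarrow> real^'d"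
  where "ula_path gradU \<gamma> \<equiv> ula gradU \<gamma> (\<lambda>i z. z i)"

lemma ula_eq_ula_path:
  "k \<le> p \<Longrightarrow> ula gradU \<gamma> Z x k \<omega> = ula_path gradU \<gamma> x k (\<lambda>i\<in>{1..p}. Z i \<omega>)"
  by (induction k) simp_all

lemma measurable_ula_path:
  assumes [measurable]: "gradU \<in> borel_measurable borel"
  shows "k \<le> p \<Longrightarrow> ula_path gradU \<gamma> x k \<in> borel_measurable (\<Pi>\<^sub>M i\<in>{1..p}. borel)"
proof (induction k)
  case 0
  have "ula_path gradU \<gamma> x 0 = (\<lambda>_. x)" by (simp add: fun_eq_iff)
  then show ?case by simp
next
  case (Suc k)
  then have [measurable]: "ula_path gradU \<gamma> x k \<in> borel_measurable (\<Pi>\<^sub>M i\<in>{1..p}. borel)" by simp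
  have [measurable]: "(\<lambda>z. z (Suc k)) \<in> borel_measurable (\<Pi>\<^sub>M i\<in>{1..p}. (borel :: (real^'d) measure))"
    using Suc.prems by (intro measurable_component_singleton) auto
  show ?case unfolding ula.simps by measurable
qed

locale langevin_noise = prob_space M
  for M :: "'w measure" and Z :: "nat \<Rightarrow> 'w \<Rightarrow> real^'d" +
  assumes Z_indep: "indep_vars (\<lambda>_. borel) Z {1..}"
    and Z_gaussian: "\<And>k. k \<ge> 1 \<Longrightarrow> distributed M lborel (Z k) std_gaussian_density"
begin

text \<open>The law over which conditioning on the past becomes an iterated integral.\<close>

definition path_law :: "nat \<Rightarrow> (nat \<Rightarrow> real^'d) measure" where
  "path_law p = distr M (\<Pi>\<^sub>M i\<in>{1..p}. borel) (\<lambda>\<omega>. \<lambda>i\<in>{1..p}. Z i \<omega>)"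

lemma measurable_Z: "k \<ge> 1 \<Longrightarrow> Z k \<in> borel_measurable M"
  using Z_indep unfolding indep_vars_def by simp

lemma measurable_path: "(\<lambda>\<omega>. \<lambda>i\<in>{1..p}. Z i \<omega>) \<in> M \<rightarrow>\<^sub>M (\<Pi>\<^sub>M i\<in>{1..p}. borel)"
  by (intro measurable_restrict measurable_Z) simp

lemma sets_path_law [measurable_cong, simp]: "sets (path_law p) = sets (\<Pi>\<^sub>M i\<in>{1..p}. borel)"
  by (simp add: path_law_def)

lemma prob_space_path_law: "prob_space (path_law p)"
  unfolding path_law_def by (rule prob_space_distr[OF measurable_path])

lemma nn_integral_path_law:
  "F \<in> borel_measurable (\<Pi>\<^sub>M i\<in>{1..p}. borel) \<Longrightarrow>
    (\<integral>\<^sup>+y. F y \<partial>path_law p) = (\<integral>\<^sup>+\<omega>. F (\<lambda>i\<in>{1..p}. Z i \<omega>) \<partial>M)"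
  unfolding path_law_def by (rule nn_integral_distr[OF measurable_path]) simp

text \<open>Independence of the blocks \<open>{1..p}\<close> and \<open>{Suc p}\<close> makes their
  joint law a product, and Tonelli turns it into an iterated integral.\<close>

lemma nn_integral_path_law_step:
  assumes F: "case_prod F \<in> borel_measurable ((\<Pi>\<^sub>M i\<in>{1..p}. borel) \<Otimes>\<^sub>M borel)"
  shows "(\<integral>\<^sup>+\<omega>. F (\<lambda>i\<in>{1..p}. Z i \<omega>) (Z (Suc p) \<omega>) \<partial>M)
    = (\<integral>\<^sup>+y. \<integral>\<^sup>+z. F y z \<partial>gaussian \<partial>path_law p)"
proof -
  let ?P = "\<lambda>J. \<Pi>\<^sub>M i\<in>J. (borel :: (real^'d) measure)"
  let ?W = "\<lambda>J \<omega>. \<lambda>i\<in>J. Z i \<omega>"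
  \<comment> \<open>\<open>\<nu>\<close> lives on functions with the single index
    \<open>Suc p\<close>, because block independence speaks of restricted families; its only
    coordinate is then identified with \<open>gaussian\<close>.\<close>
  define \<nu> where "\<nu> = distr M (?P {Suc p}) (?W {Suc p})"
  have W[measurable]: "?W {Suc p} \<in> M \<rightarrow>\<^sub>M ?P {Suc p}" "?W {1..p} \<in> M \<rightarrow>\<^sub>M ?P {1..p}"
    by (intro measurable_restrict measurable_Z; simp)+
  have comp[measurable]: "(\<lambda>g. g (Suc p)) \<in> ?P {Suc p} \<rightarrow>\<^sub>M borel"
    by (intro measurable_component_singleton) simp
  interpret \<nu>: prob_space \<nu>
    unfolding \<nu>_def by (rule prob_space_distr[OF W(1)])
  have "indep_var (?P {1..p}) (?W {1..p}) (?P {Suc p}) (?W {Suc p})"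
    by (rule indep_var_restrict[OF Z_indep]) auto
  then have law: "path_law p \<Otimes>\<^sub>M \<nu> = distr M (?P {1..p} \<Otimes>\<^sub>M ?P {Suc p}) (\<lambda>\<omega>. (?W {1..p} \<omega>, ?W {Suc p} \<omega>))"
    unfolding indep_var_distribution_eq path_law_def \<nu>_def by blast
  have "distr M lborel (Z (Suc p)) = gaussian"
    using distributed_distr_eq_density[OF Z_gaussian[of "Suc p"]] by (simp add: gaussian_def)
  moreover have "distr M lborel (Z (Suc p)) = distr \<nu> borel (\<lambda>g. g (Suc p))"
    unfolding \<nu>_def by (subst distr_distr) (auto simp: comp_def intro!: distr_cong)
  ultimately have gauss: "gaussian = distr \<nu> borel (\<lambda>g. g (Suc p))" by simp
  have sets_\<nu>[measurable_cong]: "sets \<nu> = sets (?P {Suc p})"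
    by (simp add: \<nu>_def)
  note F[measurable]
  have "(\<integral>\<^sup>+y. \<integral>\<^sup>+z. F y z \<partial>gaussian \<partial>path_law p) = (\<integral>\<^sup>+y. \<integral>\<^sup>+w. F y (w (Suc p)) \<partial>\<nu> \<partial>path_law p)"
  proof (rule nn_integral_cong)
    fix y assume "y \<in> space (path_law p)"
    then have "y \<in> space (?P {1..p})" by (simp add: path_law_def)
    then have "F y \<in> borel_measurable borel"
      using measurable_Pair2[OF F] by simp
    then show "(\<integral>\<^sup>+z. F y z \<partial>gaussian) = (\<integral>\<^sup>+w. F y (w (Suc p)) \<partial>\<nu>)"
      unfolding gauss by (intro nn_integral_distr) simp_all
  qed
  also have "\<dots> = (\<integral>\<^sup>+q. F (fst q) (snd q (Suc p)) \<partial>(path_law p \<Otimes>\<^sub>M \<nu>))"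
    by (subst \<nu>.nn_integral_fst[symmetric]) simp_all
  also have "\<dots> = (\<integral>\<^sup>+\<omega>. F (?W {1..p} \<omega>) (Z (Suc p) \<omega>) \<partial>M)"
  proof -
    have m1: "(\<lambda>\<omega>. (?W {1..p} \<omega>, ?W {Suc p} \<omega>)) \<in> M \<rightarrow>\<^sub>M ?P {1..p} \<Otimes>\<^sub>M ?P {Suc p}"
      by (intro measurable_Pair W)
    have "(\<lambda>q. (fst q, snd q (Suc p))) \<in> ?P {1..p} \<Otimes>\<^sub>M ?P {Suc p} \<rightarrow>\<^sub>M ?P {1..p} \<Otimes>\<^sub>M borel"
      by (intro measurable_Pair measurable_fst measurable_compose[OF measurable_snd comp])
    from measurable_compose[OF this F]
    have m2: "(\<lambda>q. F (fst q) (snd q (Suc p))) \<in> borel_measurable (?P {1..p} \<Otimes>\<^sub>M ?P {Suc p})"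
      by simp
    show ?thesis
      unfolding law using m2 by (subst nn_integral_distr[OF m1]) simp_all
  qed
  finally show ?thesis by simp
qed

end

section \<open>One-step recursion for weighted sums along the chain\<close>

text \<open>The weights \<open>a\<close> and factors \<open>\<rho>\<close> stay abstract, so one
  recursion covers the burn-in, where the weights are 0, and the averaging window.\<close>

locale langevin_sums = langevin_noise M Z
  for M :: "'w measure" and Z :: "nat \<Rightarrow> 'w \<Rightarrow> real^'d" +
  fixes gradU :: "real^'d \<Rightarrow> real^'d" and \<gamma> :: "nat \<Rightarrow> real" and x :: "real^'d"
    and f :: "real^'d \<Rightarrow> real" and F :: real and a :: "nat \<Rightarrow> real" and \<rho> :: "nat \<Rightarrow> real"
  assumes gradU_measurable [measurable]: "gradU \<in> borel_measurable borel"
    and \<gamma>_nonneg: "\<And>k. k \<ge> 1 \<Longrightarrow> 0 \<le> \<gamma> k"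
    and f_lip: "F-lipschitz_on UNIV f"
    and a_nonneg: "\<And>k. 0 \<le> a k"
    and contraction: "\<And>k y z. k \<ge> 1 \<Longrightarrow>
      norm ((y - \<gamma> k *\<^sub>R gradU y) - (z - \<gamma> k *\<^sub>R gradU z)) \<le> \<rho> k * norm (y - z)"
    and \<rho>_nonneg: "\<And>k. k \<ge> 1 \<Longrightarrow> 0 \<le> \<rho> k"
begin

text \<open>\<open>\<phi>\<close> stands for the conditional expectation of the later terms as a
  function of the current state. Quantifying over all \<open>\<Lambda>\<close>-Lipschitz
  \<open>\<phi>\<close> turns the backward propagation of Lipschitz constants into a forward
  induction on \<open>k\<close>.\<close>

definition spread :: "nat \<Rightarrow> real \<Rightarrow> real \<Rightarrow> bool" where
  "spread k \<Lambda> B \<longleftrightarrow> (\<forall>\<phi>. \<Lambda>-lipschitz_on UNIV \<phi> \<longrightarrow> (\<exists>c.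
    (\<integral>\<^sup>+\<omega>. ennreal (((\<Sum>i=1..k. a i * f (ula gradU \<gamma> Z x i \<omega>)) + \<phi> (ula gradU \<gamma> Z x k \<omega>) - c)\<^sup>2) \<partial>M)
      \<le> ennreal B))"

lemma spread_mono: "spread k \<Lambda>' B \<Longrightarrow> \<Lambda> \<le> \<Lambda>' \<Longrightarrow> spread k \<Lambda> B"
  unfolding spread_def using lipschitz_on_le by blast

lemma spread_0:
  assumes "0 \<le> B"
  shows "spread 0 \<Lambda> B"
  unfolding spread_def
proof (intro allI impI)
  fix \<phi> :: "real^'d \<Rightarrow> real"
  show "\<exists>c. (\<integral>\<^sup>+\<omega>. ennreal (((\<Sum>i=1..0. a i * f (ula gradU \<gamma> Z x i \<omega>)) + \<phi> (ula gradU \<gamma> Z x 0 \<omega>) - c)\<^sup>2) \<partial>M)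
      \<le> ennreal B"
    by (rule exI[of _ "\<phi> x"]) simp
qed

text \<open>The new term and \<open>\<phi>\<close> merge into one
  \<open>\<Lambda>'\<close>-Lipschitz function \<open>\<psi>\<close> of the new state. Averaging out
  the last noise costs \<open>2 * \<gamma> (Suc k) * \<Lambda>'\<^sup>2\<close>; the conditional
  mean is \<open>\<psi>b\<close> after the drift \<open>T\<close>, hence
  \<open>\<rho> (Suc k) * \<Lambda>'\<close>-Lipschitz in the old state.\<close>

lemma spread_Suc:
  assumes IH: "spread k (\<rho> (Suc k) * \<Lambda>') B" and \<Lambda>': "\<Lambda>' = a (Suc k) * F + \<Lambda>" and B: "0 \<le> B"
  shows "spread (Suc k) \<Lambda> (2 * \<gamma> (Suc k) * \<Lambda>'\<^sup>2 + B)"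
  unfolding spread_def
proof (intro allI impI)
  fix \<phi> :: "real^'d \<Rightarrow> real" assume \<phi>: "\<Lambda>-lipschitz_on UNIV \<phi>"
  define \<psi> where "\<psi> y = a (Suc k) * f y + \<phi> y" for y
  have \<psi>: "\<Lambda>'-lipschitz_on UNIV \<psi>"
    unfolding \<psi>_def[abs_def] \<Lambda>' using lipschitz_on_cmult_real[OF f_lip, of "a (Suc k)"] a_nonneg[of "Suc k"] \<phi>
    by (intro lipschitz_on_add) auto
  have [measurable]: "\<psi> \<in> borel_measurable borel" "f \<in> borel_measurable borel"
    by (rule lipschitz_borel_measurable[OF \<psi>] lipschitz_borel_measurable[OF f_lip])+
  define g where "g = \<gamma> (Suc k)"
  define s where "s = sqrt (2 * g)"
  have g: "0 \<le> g" using \<gamma>_nonneg by (simp add: g_def)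
  define T where "T y = y - g *\<^sub>R gradU y" for y
  have [measurable]: "T \<in> borel_measurable borel" unfolding T_def by measurable
  have T: "norm (T y - T z) \<le> \<rho> (Suc k) * norm (y - z)" for y z
    using contraction[of "Suc k" y z] by (simp add: T_def g_def)
  define \<psi>b where "\<psi>b y = (\<integral>z. \<psi> (y + s *\<^sub>R z) \<partial>gaussian)" for y
  have \<psi>b: "\<Lambda>'-lipschitz_on UNIV \<psi>b"
    unfolding \<psi>b_def by (rule lipschitz_average[OF prob_space_gaussian \<psi>])
      (simp_all add: integrable_gaussian_norm)
  have \<Lambda>'_nonneg: "0 \<le> \<Lambda>'" by (rule lipschitz_on_nonneg[OF \<psi>])
  have "(\<rho> (Suc k) * \<Lambda>')-lipschitz_on UNIV (\<lambda>y. \<psi>b (T y))"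
  proof (rule lipschitz_absI)
    fix y z
    have "\<bar>\<psi>b (T y) - \<psi>b (T z)\<bar> \<le> \<Lambda>' * norm (T y - T z)"
      by (rule lipschitz_abs_le[OF \<psi>b])
    also have "\<dots> \<le> \<Lambda>' * (\<rho> (Suc k) * norm (y - z))"
      using \<Lambda>'_nonneg T by (rule mult_left_mono[rotated])
    finally show "\<bar>\<psi>b (T y) - \<psi>b (T z)\<bar> \<le> \<rho> (Suc k) * \<Lambda>' * norm (y - z)"
      by (simp add: mult_ac)
  qed (use \<rho>_nonneg \<Lambda>'_nonneg in simp)
  then obtain c where c: "(\<integral>\<^sup>+\<omega>. ennreal (((\<Sum>i=1..k. a i * f (ula gradU \<gamma> Z x i \<omega>))
      + \<psi>b (T (ula gradU \<gamma> Z x k \<omega>)) - c)\<^sup>2) \<partial>M) \<le> ennreal B"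
    using IH unfolding spread_def by blast
  have [measurable]: "\<psi>b \<in> borel_measurable borel" by (rule lipschitz_borel_measurable[OF \<psi>b])
  define A where "A y = (\<Sum>i=1..k. a i * f (ula_path gradU \<gamma> x i y))" for y
  define X where "X y = ula_path gradU \<gamma> x k y" for y
  have [measurable]: "X \<in> borel_measurable (\<Pi>\<^sub>M i\<in>{1..k}. borel)"
    unfolding X_def by (rule measurable_ula_path[OF gradU_measurable]) simp
  have [measurable]: "A \<in> borel_measurable (\<Pi>\<^sub>M i\<in>{1..k}. borel)"
    unfolding A_def
  proof (rule borel_measurable_sum)
    fix i assume "i \<in> {1..k}"
    then have [measurable]: "ula_path gradU \<gamma> x i \<in> borel_measurable (\<Pi>\<^sub>M i\<in>{1..k}. borel)"
      by (intro measurable_ula_path gradU_measurable) simp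
    show "(\<lambda>y. a i * f (ula_path gradU \<gamma> x i y)) \<in> borel_measurable (\<Pi>\<^sub>M i\<in>{1..k}. borel)"
      by measurable
  qed
  let ?W = "\<lambda>\<omega>. \<lambda>i\<in>{1..k}. Z i \<omega>"
  have A_eq: "A (?W \<omega>) = (\<Sum>i=1..k. a i * f (ula gradU \<gamma> Z x i \<omega>))" for \<omega>
    unfolding A_def
  proof (rule sum.cong[OF refl])
    fix i assume "i \<in> {1..k}"
    then have "ula gradU \<gamma> Z x i \<omega> = ula_path gradU \<gamma> x i (?W \<omega>)"
      by (intro ula_eq_ula_path) simp
    then show "a i * f (ula_path gradU \<gamma> x i (?W \<omega>)) = a i * f (ula gradU \<gamma> Z x i \<omega>)"
      by (simp only:)
  qed
  have X_eq: "X (?W \<omega>) = ula gradU \<gamma> Z x k \<omega>" for \<omega>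
    unfolding X_def by (rule ula_eq_ula_path[OF order_refl, symmetric])
  define G where "G y z = A y + \<psi> (T (X y) + s *\<^sub>R z)" for y z
  have G_lip: "(\<Lambda>' * s)-lipschitz_on UNIV (G y)" for y
  proof -
    have "(0 + \<Lambda>' * \<bar>s\<bar>)-lipschitz_on UNIV (\<lambda>z. A y + \<psi> (T (X y) + s *\<^sub>R z))"
      by (intro lipschitz_on_add lipschitz_affine[OF \<psi>] lipschitz_on_constant)
    then show ?thesis using g by (simp add: G_def[abs_def] s_def)
  qed
  have G_mean: "(\<integral>z. G y z \<partial>gaussian) = A y + \<psi>b (T (X y))" for y
  proof -
    have "integrable gaussian (\<lambda>z. \<psi> (T (X y) + s *\<^sub>R z))"
      by (rule integrable_gaussian_lipschitz[OF lipschitz_affine[OF \<psi>]])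
    then show ?thesis by (simp add: G_def \<psi>b_def measure_gaussian_UNIV)
  qed
  have "(\<integral>\<^sup>+y. \<integral>\<^sup>+z. ennreal ((G y z - c)\<^sup>2) \<partial>gaussian \<partial>path_law k) \<le> ennreal ((\<Lambda>' * s)\<^sup>2 + B)"
  proof (rule two_stage_second_moment[OF prob_space_gaussian])
    show "G y \<in> borel_measurable gaussian" for y
      using lipschitz_borel_measurable[OF G_lip] by simp
    show "\<exists>c. (\<integral>\<^sup>+z. ennreal ((G y z - c)\<^sup>2) \<partial>gaussian) \<le> ennreal ((\<Lambda>' * s)\<^sup>2)" for y
      using gaussian_lipschitz_second_moment[OF G_lip] by blast
    show "(\<lambda>y. \<integral>z. G y z \<partial>gaussian) \<in> borel_measurable (path_law k)"
      unfolding G_mean by measurable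
    show "prob_space (path_law k)" by (rule prob_space_path_law)
    show "(\<integral>\<^sup>+y. ennreal (((\<integral>z. G y z \<partial>gaussian) - c)\<^sup>2) \<partial>path_law k) \<le> ennreal B"
      unfolding G_mean using c by (subst nn_integral_path_law) (simp_all only: A_eq X_eq, measurable)
  qed (use B in auto)
  also have "(\<integral>\<^sup>+y. \<integral>\<^sup>+z. ennreal ((G y z - c)\<^sup>2) \<partial>gaussian \<partial>path_law k)
      = (\<integral>\<^sup>+\<omega>. ennreal ((G (?W \<omega>) (Z (Suc k) \<omega>) - c)\<^sup>2) \<partial>M)"
    by (subst nn_integral_path_law_step[symmetric]) (unfold G_def, measurable)
  also have "(\<lambda>\<omega>. G (?W \<omega>) (Z (Suc k) \<omega>)) = (\<lambda>\<omega>.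
      (\<Sum>i=1..Suc k. a i * f (ula gradU \<gamma> Z x i \<omega>)) + \<phi> (ula gradU \<gamma> Z x (Suc k) \<omega>))"
    unfolding G_def A_eq X_eq by (simp add: fun_eq_iff \<psi>_def T_def g_def s_def)
  also have "(\<Lambda>' * s)\<^sup>2 = 2 * \<gamma> (Suc k) * \<Lambda>'\<^sup>2"
    using g by (simp add: power_mult_distrib s_def g_def)
  finally show "\<exists>c. (\<integral>\<^sup>+\<omega>. ennreal (((\<Sum>i=1..Suc k. a i * f (ula gradU \<gamma> Z x i \<omega>))
      + \<phi> (ula gradU \<gamma> Z x (Suc k) \<omega>) - c)\<^sup>2) \<partial>M) \<le> ennreal (2 * \<gamma> (Suc k) * \<Lambda>'\<^sup>2 + B)"
    by (intro exI[of _ c])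
qed

end

section \<open>Choice of the Lipschitz constants and summation of the costs\<close>

theorem theorem15:
  fixes U :: "real ^ 'd \<Rightarrow> real"
    and gradU :: "real ^ 'd \<Rightarrow> real ^ 'd"
    and L m :: real
    and \<gamma> :: "nat \<Rightarrow> real"
    and f :: "real ^ 'd \<Rightarrow> real"
    and M :: "'w measure"
    and Z :: "nat \<Rightarrow> 'w \<Rightarrow> real ^ 'd"
    and N n :: nat
    and x :: "real ^ 'd"
  assumes U_grad: "\<And>y. GDERIV U y :> gradU y"
    and U_C1: "continuous_on UNIV gradU"
    and L: "L \<ge> 0"
    and m: "m > 0"
    and grad_lipschitz: "\<And>y z. norm (gradU y - gradU z) \<le> L * norm (y - z)"
    and strong_convexity:
      "\<And>y z. U z \<ge> U y + gradU y \<bullet> (z - y) + (m / 2) * (norm (y - z))\<^sup>2"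
    and \<gamma>_pos: "\<And>k. k \<ge> 1 \<Longrightarrow> \<gamma> k > 0"
    and \<gamma>_antimono: "antimono_on {1..} \<gamma>"
    and \<gamma>_bound: "\<gamma> 1 \<le> 2 / (m + L)"
    and f_lipschitz: "\<exists>C. C-lipschitz_on UNIV f"
    and M: "prob_space M"
    and Z_indep: "prob_space.indep_vars M (\<lambda>_. borel) Z {1..}"
    and Z_gaussian: "\<And>k. k \<ge> 1 \<Longrightarrow> distributed M lborel (Z k) std_gaussian_density"
    and n: "n \<ge> 1"
  shows "integrable M (\<lambda>\<omega>. (weighted_average \<gamma> N n f (ula gradU \<gamma> Z x) \<omega>)\<^sup>2) \<and>
    prob_space.variance M (weighted_average \<gamma> N n f (ula gradU \<gamma> Z x))
      \<le> 8 * inverse ((kappa m L)\<^sup>2) * (lip_norm f)\<^sup>2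
          * inverse (step_sum \<gamma> (N + 2) (N + n + 1)) * var_factor m L \<gamma> N n"
proof -
  interpret langevin_noise M Z
    by (intro langevin_noise.intro langevin_noise_axioms.intro M Z_indep Z_gaussian)
  have mL: "m \<le> L"
    by (rule smooth_imp_convexity_le_lipschitz[OF U_grad grad_lipschitz strong_convexity])
  obtain C where C: "C-lipschitz_on UNIV f" using f_lipschitz by blast
  define F where "F = lip_norm f"
  have F: "F-lipschitz_on UNIV f" unfolding F_def by (rule lip_norm_lipschitz[OF C])
  have F_nonneg: "0 \<le> F" by (rule lipschitz_on_nonneg[OF F])
  define \<kappa> where "\<kappa> = kappa m L"
  have \<kappa>: "0 < \<kappa>" unfolding \<kappa>_def by (rule kappa_pos[OF m mL])
  have \<gamma>_le: "\<gamma> k \<le> 2 / (m + L)" if "k \<ge> 1" for k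
    using monotone_onD[OF \<gamma>_antimono, of 1 k] that \<gamma>_bound by simp
  have \<kappa>\<gamma>: "\<kappa> * \<gamma> k \<le> 1" if "k \<ge> 1" for k
    unfolding \<kappa>_def using kappa_step_le_1[OF m mL _ \<gamma>_le[OF that]] \<gamma>_pos[OF that] by simp
  define \<Gamma> where "\<Gamma> = step_sum \<gamma> (N + 2) (N + n + 1)"
  have \<Gamma>: "0 < \<Gamma>"
    unfolding \<Gamma>_def step_sum_def using n by (intro sum_pos \<gamma>_pos) auto
  \<comment> \<open>Extending the weights by 0 below the window makes the estimator a sum over
    \<open>1..N+n\<close>, the form treated by \<open>spread\<close>.\<close>
  define a where "a k = (if k \<in> {N+1..N+n} then \<gamma> (k + 1) / \<Gamma> else 0)" for k
  define \<rho> where "\<rho> k = sqrt (1 - \<kappa> * \<gamma> k)" for k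
  interpret langevin_sums M Z gradU \<gamma> x f F a \<rho>
  proof
    show "gradU \<in> borel_measurable borel"
      by (rule borel_measurable_continuous_onI[OF U_C1])
    show "0 \<le> \<gamma> k" if "k \<ge> 1" for k using \<gamma>_pos[OF that] by simp
    show "F-lipschitz_on UNIV f" by (rule F)
    show "0 \<le> a k" for k using \<Gamma> \<gamma>_pos[of "k + 1"] by (simp add: a_def)
    show "0 \<le> \<rho> k" if "k \<ge> 1" for k using \<kappa>\<gamma>[OF that] by (simp add: \<rho>_def)
    show "norm ((y - \<gamma> k *\<^sub>R gradU y) - (z - \<gamma> k *\<^sub>R gradU z)) \<le> \<rho> k * norm (y - z)" if "k \<ge> 1" for k y z
      unfolding \<rho>_def \<kappa>_def
      using \<gamma>_pos[OF that] \<gamma>_le[OF that]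
      by (intro gradient_step_contraction[OF _ m mL]
        strongly_convex_cocoercive[OF U_grad grad_lipschitz strong_convexity mL]) auto
  qed
  \<comment> \<open>The exact square serves the burn-in; the linear bound makes the recursion with
    weights solvable by a constant.\<close>
  have \<rho>_sq: "(\<rho> k)\<^sup>2 = 1 - \<kappa> * \<gamma> k" and \<rho>_le: "\<rho> k \<le> 1 - \<kappa> * \<gamma> k / 2" if "k \<ge> 1" for k
  proof -
    show sq: "(\<rho> k)\<^sup>2 = 1 - \<kappa> * \<gamma> k" using \<kappa>\<gamma>[OF that] by (simp add: \<rho>_def)
    have "1 - \<kappa> * \<gamma> k \<le> (1 - \<kappa> * \<gamma> k / 2)\<^sup>2"
      by (simp add: power2_diff)
    then show "\<rho> k \<le> 1 - \<kappa> * \<gamma> k / 2"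
      unfolding \<rho>_def using \<kappa>\<gamma>[OF that] by (intro real_le_lsqrt) auto
  qed
  \<comment> \<open>The value \<open>2 * \<Lambda>\<^sup>2 / \<kappa>\<close> is invariant: each
    step costs exactly what the contraction by \<open>1 - \<kappa> * \<gamma> k\<close> removes, so
    the bound does not grow with the length of the burn-in.\<close>
  have burn_in: "k \<le> N \<Longrightarrow> 0 \<le> \<Lambda> \<Longrightarrow> spread k \<Lambda> (2 * \<Lambda>\<^sup>2 / \<kappa>)" for k \<Lambda>
  proof (induction k arbitrary: \<Lambda>)
    case 0
    have "0 \<le> 2 * \<Lambda>\<^sup>2 / \<kappa>" using \<kappa> by simp
    then show ?case by (rule spread_0)
  next
    case (Suc k)
    have "0 \<le> \<rho> (Suc k) * \<Lambda>" using Suc.prems \<rho>_nonneg by simp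
    then have IH: "spread k (\<rho> (Suc k) * \<Lambda>) (2 * (\<rho> (Suc k) * \<Lambda>)\<^sup>2 / \<kappa>)"
      using Suc.prems by (intro Suc.IH) auto
    have "spread (Suc k) \<Lambda> (2 * \<gamma> (Suc k) * \<Lambda>\<^sup>2 + 2 * (\<rho> (Suc k) * \<Lambda>)\<^sup>2 / \<kappa>)"
      using Suc.prems \<kappa> by (intro spread_Suc[OF IH]) (auto simp: a_def)
    moreover have "2 * \<gamma> (Suc k) * \<Lambda>\<^sup>2 + 2 * (\<rho> (Suc k) * \<Lambda>)\<^sup>2 / \<kappa> = 2 * \<Lambda>\<^sup>2 / \<kappa>"
      using \<kappa> by (simp add: power_mult_distrib \<rho>_sq field_simps)
    ultimately show ?case by simp
  qed
  \<comment> \<open>\<open>\<Lambda>\<close> is the fixed point of the backward recursion for the Lipschitz constants: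
    \<open>a\<^sub>k F = (\<kappa> \<gamma>\<^sub>k\<^sub>+\<^sub>1 / 2) \<Lambda>\<close>.\<close>
  define \<Lambda> where "\<Lambda> = 2 * F / (\<kappa> * \<Gamma>)"
  have \<Lambda>: "0 \<le> \<Lambda>" using F_nonneg \<kappa> \<Gamma> by (simp add: \<Lambda>_def)
  \<comment> \<open>The weight at index \<open>k\<close> carries \<open>\<gamma> (k + 1)\<close>,
    the step that contracts everything later; hence the shifted index. Adding \<open>a k * F\<close>
    restores the constant \<open>\<Lambda>\<close>, so each noise in the window costs
    \<open>2 * \<gamma> k * \<Lambda>\<^sup>2\<close>.\<close>
  have averaging: "j \<le> n \<Longrightarrow> spread (N + j) ((1 - \<kappa> * \<gamma> (N + j + 1) / 2) * \<Lambda>)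
      (2 * \<Lambda>\<^sup>2 * (1 / \<kappa> + (\<Sum>k=N+1..N+j. \<gamma> k)))" for j
  proof (induction j)
    case 0
    have "0 \<le> \<kappa> * \<gamma> (N + 1)"
      using \<kappa> \<gamma>_nonneg[of "N + 1"] by simp
    then have "1 - \<kappa> * \<gamma> (N + 1) / 2 \<le> 1"
      by simp
    from mult_right_mono[OF this \<Lambda>]
    have "(1 - \<kappa> * \<gamma> (N + 1) / 2) * \<Lambda> \<le> \<Lambda>" by (simp only: mult_1_left)
    from spread_mono[OF burn_in[OF order_refl \<Lambda>] this]
    show ?case by (simp only: add_0_right) simp
  next
    case (Suc j)
    define k where "k = N + j"
    let ?B = "2 * \<Lambda>\<^sup>2 * (1 / \<kappa> + (\<Sum>k=N+1..N+j. \<gamma> k))"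
    have "0 \<le> (\<Sum>k=N+1..N+j. \<gamma> k)" by (intro sum_nonneg) (use \<gamma>_nonneg in auto)
    then have B: "0 \<le> ?B" using \<kappa> by simp
    have "spread k ((1 - \<kappa> * \<gamma> (Suc k) / 2) * \<Lambda>) ?B"
      using Suc by (simp add: k_def)
    then have IH: "spread k (\<rho> (Suc k) * \<Lambda>) ?B"
      using \<Lambda> \<rho>_le[of "Suc k"] by (elim spread_mono) (intro mult_right_mono, auto)
    have "\<Lambda> = a (Suc k) * F + (1 - \<kappa> * \<gamma> (Suc (Suc k)) / 2) * \<Lambda>"
    proof -
      have "a (Suc k) = \<gamma> (Suc (Suc k)) / \<Gamma>" using Suc.prems by (simp add: a_def k_def)
      then have "a (Suc k) * F = \<kappa> * \<gamma> (Suc (Suc k)) / 2 * \<Lambda>"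
        using \<kappa> \<Gamma> by (simp add: \<Lambda>_def)
      then show ?thesis by (simp add: left_diff_distrib)
    qed
    from spread_Suc[OF IH this B]
    have "spread (Suc k) ((1 - \<kappa> * \<gamma> (Suc (Suc k)) / 2) * \<Lambda>) (2 * \<gamma> (Suc k) * \<Lambda>\<^sup>2 + ?B)" .
    moreover have "2 * \<gamma> (Suc k) * \<Lambda>\<^sup>2 + ?B = 2 * \<Lambda>\<^sup>2 * (1 / \<kappa> + (\<Sum>k=N+1..N+Suc j. \<gamma> k))"
      by (simp add: k_def algebra_simps)
    ultimately show ?case by (simp add: k_def)
  qed
  define B where "B = 2 * \<Lambda>\<^sup>2 * (1 / \<kappa> + (\<Sum>k=N+1..N+n. \<gamma> k))"
  have B: "0 \<le> B"
    unfolding B_def using \<kappa> \<gamma>_nonneg by (intro mult_nonneg_nonneg add_nonneg_nonneg sum_nonneg) auto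
  let ?S = "weighted_average \<gamma> N n f (ula gradU \<gamma> Z x)"
  have "0 \<le> (1 - \<kappa> * \<gamma> (N + n + 1) / 2) * \<Lambda>"
    using \<kappa>\<gamma>[of "N + n + 1"] \<Lambda> by simp
  \<comment> \<open>Past the window no terms remain, so the zero function closes the
    recursion.\<close>
  then have "((1 - \<kappa> * \<gamma> (N + n + 1) / 2) * \<Lambda>)-lipschitz_on UNIV (\<lambda>_::real^'d. 0::real)"
    by (rule lipschitz_on_le[OF lipschitz_on_constant])
  then obtain c where c: "(\<integral>\<^sup>+\<omega>. ennreal (((\<Sum>i=1..N+n. a i * f (ula gradU \<gamma> Z x i \<omega>)) + 0 - c)\<^sup>2) \<partial>M)
      \<le> ennreal B"
    using averaging[of n] unfolding spread_def B_def by blast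
  have S_eq: "(\<Sum>i=1..N+n. a i * f (ula gradU \<gamma> Z x i \<omega>)) = ?S \<omega>" for \<omega>
    unfolding weighted_average_def
    by (rule sum.mono_neutral_cong_right) (auto simp: a_def weight_def \<Gamma>_def)
  have c: "(\<integral>\<^sup>+\<omega>. ennreal ((?S \<omega> - c)\<^sup>2) \<partial>M) \<le> ennreal B"
    using c by (simp only: S_eq add_0_right)
  have S_meas: "?S \<in> borel_measurable M"
  proof -
    have [measurable]: "f \<in> borel_measurable borel" by (rule lipschitz_borel_measurable[OF F])
    have [measurable]: "ula gradU \<gamma> Z x k \<in> borel_measurable M" for k
    proof -
      have "(\<lambda>\<omega>. ula_path gradU \<gamma> x k (\<lambda>i\<in>{1..k}. Z i \<omega>)) \<in> borel_measurable M"
        by (rule measurable_compose[OF measurable_path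
          measurable_ula_path[OF gradU_measurable order_refl]])
      also have "(\<lambda>\<omega>. ula_path gradU \<gamma> x k (\<lambda>i\<in>{1..k}. Z i \<omega>)) = ula gradU \<gamma> Z x k"
        by (rule ext) (rule ula_eq_ula_path[OF order_refl, symmetric])
      finally show ?thesis .
    qed
    show ?thesis unfolding weighted_average_def[abs_def] by measurable
  qed
  have "B \<le> 8 * inverse (\<kappa>\<^sup>2) * F\<^sup>2 * inverse \<Gamma> * var_factor m L \<gamma> N n"
  proof -
    \<comment> \<open>The costs run over \<open>N+1..N+n\<close> but \<open>\<Gamma>\<close> over
      \<open>N+2..N+n+1\<close>. Adding the last step and bounding the first by
      \<open>2 / (m + L)\<close> produces that term of \<open>var_factor\<close>.\<close>
    have "(\<Sum>k=N+1..N+n. \<gamma> k) \<le> (\<Sum>k=N+1..N+n+1. \<gamma> k)"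
      using \<gamma>_nonneg by (intro sum_mono2) auto
    also have "\<dots> = \<gamma> (N + 1) + \<Gamma>"
      unfolding \<Gamma>_def step_sum_def by (subst sum.atLeast_Suc_atMost) auto
    also have "\<dots> \<le> 2 / (m + L) + \<Gamma>"
      using \<gamma>_le[of "N + 1"] by simp
    finally have "B \<le> 2 * \<Lambda>\<^sup>2 * (1 / \<kappa> + (2 / (m + L) + \<Gamma>))"
      unfolding B_def by (intro mult_left_mono add_left_mono) auto
    also have "\<dots> = 8 * inverse (\<kappa>\<^sup>2) * F\<^sup>2 * inverse \<Gamma> * ((1 / \<kappa> + (2 / (m + L) + \<Gamma>)) * inverse \<Gamma>)"
      by (simp add: \<Lambda>_def power_divide power_mult_distrib divide_inverse power2_eq_square mult_ac)
    also have "(1 / \<kappa> + (2 / (m + L) + \<Gamma>)) * inverse \<Gamma> = var_factor m L \<gamma> N n"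
    proof -
      have "(p + (q + \<Gamma>)) * inverse \<Gamma> = 1 + inverse \<Gamma> * (p + q)" for p q
        using \<Gamma> by (simp add: field_simps)
      then show ?thesis
        unfolding var_factor_def \<Gamma>_def[symmetric] \<kappa>_def[symmetric]
        by (simp only: inverse_eq_divide[of \<kappa>])
    qed
    finally show ?thesis .
  qed
  then have "variance ?S \<le> 8 * inverse (\<kappa>\<^sup>2) * F\<^sup>2 * inverse \<Gamma> * var_factor m L \<gamma> N n"
    using second_moment_variance[OF S_meas c B] by linarith
  then show ?thesis
    using second_moment_integrable2[OF S_meas c B] unfolding \<kappa>_def F_def \<Gamma>_def by blast
qed

end
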